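(* Let $P$, $U$, $V$ and the sequences of polygons $M(k)=(M_1(k),\dots,M_{2n}(k))$, $k\ge 0$, and $N(k)=(N_{1+\frac12}(k),\dots,N_{2n+\frac12}(k))$, $k\ge1$, be as described in the context. Then the set $$O(P)=\bigcap_{k\ge 0}\Big(\overline{M(k)}\cap\overline{N(k+1)}\Big)$$ consists of exactly one point $O$, and the polygons $M(k)$ and $N(k)$ converge to $O$, i.e. $M_i(k)\to O$ and $N_{i+\frac12}(k)\to O$ as $k\to\infty$, for every index $i$.
   Context: Notation: for $x,y\in\mathbb{R}^2$, $[x,y]$ is the determinant of the $2\times 2$ matrix with columns $x,y$. Fix $n\ge 2$; integer indices are read modulo $2n$ and half-integer indices $j+\frac12$ likewise modulo $2n$. Let $U$ be a convex $2n$-gon with distinct vertices $U_1,\dots,U_{2n}$ in counterclockwise order, centrally symmetric about the origin: $U_{i+n}=-U_i$ (so $[U_i,U_{i+1}]>0$). Put $V_{i+\frac12}=(U_{i+1}-U_i)/[U_i,U_{i+1}]$; then $V_{i+n+\frac12}=-V_{i+\frac12}$ and $U_i=-(V_{i+\frac12}-V_{i-\frac12})/[V_{i-\frac12},V_{i+\frac12}]$. Let $c>0$ and let $P$ be a convex polygon with nonempty interior whose vertex list is $P_1,\dots,P_{2n}$ (consecutive entries may coincide) such that for all $i$, $P_{i+1}-P_i=\lambda_{i+\frac12}V_{i+\frac12}$ with $\lambda_{i+\frac12}\ge 0$, and $P_i-P_{i+n}=2cU_i$ (so $P$ has constant width in the norm with unit ball $U$). By abuse of notation $P$ also denotes its boundary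 polygonal curve. Involute operations. (a) If $X=(X_1,\dots,X_{2n})$ satisfies $X_{i+n}=X_i$ and $X_{i+1}-X_i=a_{i+\frac12}(U_{i+1}-U_i)$ for all $i$, define $\mathrm{Inv}(X)=Y$ by $Y_{i+\frac12}=X_i+b_iV_{i+\frac12}$, where $b_i=\frac12\sum_{j=i}^{i+n-1}a_{j+\frac12}[U_j,U_{j+1}]$. Then $Y_{i+n+\frac12}=Y_{i+\frac12}$ and $Y_{i+\frac12}-Y_{i-\frac12}=b_i(V_{i+\frac12}-V_{i-\frac12})$. (b) If $Y=(Y_{1+\frac12},\dots,Y_{2n+\frac12})$ satisfies $Y_{i+n+\frac12}=Y_{i+\frac12}$ and $Y_{i+\frac12}-Y_{i-\frac12}=b_i(V_{i+\frac12}-V_{i-\frac12})$ for all $i$, define $\mathrm{Inv}(Y)=X$ by $X_i=Y_{i+\frac12}+t_{i+\frac12}U_i$ with $t_{i+\frac12}=-\frac12\sum_{j=i+1}^{i+n}b_j[V_{j-\frac12},V_{j+\frac12}]$; equivalently $X$ is the polygon with $X_{i+n}=X_i$ such that for every $i$ the lines $X_i+sU_i$ and $X_{i+1}+sU_{i+1}$ ($s\in\mathbb{R}$) meet at $Y_{i+\frac12}$. Then $X_{i+1}-X_i=t_{i+\frac12}(U_{i+1}-U_i)$. Sequences: $M(0)=M$ is the central equidistant $M_i=\frac12(P_i+P_{i+n})$, and recursively $N(k+1)=\mathrm{Inv}(M(k))$, $M(k)=\mathrm{Inv}(N(k))$ for $k\ge1$. Regions: for a closed polygonal curve $X$, its exterior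 is the set of points of the plane that can be joined to a point of $P$ by a continuous path not meeting $X$, and $\overline{X}$ (the region bounded by $X$) is the complement of the exterior. *)

theory Defs
  imports "HOL-Analysis.Analysis"
begin

text \<open>Conventions. Points of the plane are vectors of type real^2.
Integer-indexed vertices X_i are functions int => real^2 (read modulo 2n).
A half-integer index j + 1/2 is encoded by the integer j, i.e. V j stands for
V_{j+1/2}, and for a half-integer polygon Y, Y j stands for Y_{j+1/2}.\<close>

definition det2 :: "real^2 \<Rightarrow> real^2 \<Rightarrow> real" where
  "det2 x y = x$1 * y$2 - x$2 * y$1"

definition Vvec :: "(int \<Rightarrow> real^2) \<Rightarrow> int \<Rightarrow> real^2" where
  "Vvec U i = (1 / det2 (U i) (U (i+1))) *\<^sub>R (U (i+1) - U i)"

text \<open>the scalar a with w = a * d (for w parallel to the nonzero vector d)\<close>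
definition coef :: "real^2 \<Rightarrow> real^2 \<Rightarrow> real" where
  "coef w d = (w \<bullet> d) / (d \<bullet> d)"

text \<open>Involute (a): from an integer-indexed polygon X to a half-integer-indexed one.\<close>
definition InvM :: "nat \<Rightarrow> (int \<Rightarrow> real^2) \<Rightarrow> (int \<Rightarrow> real^2) \<Rightarrow> (int \<Rightarrow> real^2)" where
  "InvM n U X = (\<lambda>i. let a = (\<lambda>j. coef (X (j+1) - X j) (U (j+1) - U j));
                         b = (1/2) * (\<Sum>j\<in>{i..i + int n - 1}. a j * det2 (U j) (U (j+1)))
                     in X i + b *\<^sub>R Vvec U i)"

text \<open>Involute (b): from a half-integer-indexed polygon Y (Y j = Y_{j+1/2}) to an
integer-indexed one.\<close>
definition InvN :: "nat \<Rightarrow> (int \<Rightarrow> real^2) \<Rightarrow> (int \<Rightarrow> real^2) \<Rightarrow> (int \<Rightarrow> real^2)" where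
  "InvN n U Y = (\<lambda>i. let V = Vvec U;
                         b = (\<lambda>j. coef (Y j - Y (j-1)) (V j - V (j-1)));
                         t = - (1/2) * (\<Sum>j\<in>{i+1..i + int n}. b j * det2 (V (j-1)) (V j))
                     in Y i + t *\<^sub>R U i)"

text \<open>M(k): M(0) is the central equidistant, M(k+1) = Inv(Inv(M(k))).\<close>
fun Mseq :: "nat \<Rightarrow> (int \<Rightarrow> real^2) \<Rightarrow> (int \<Rightarrow> real^2) \<Rightarrow> nat \<Rightarrow> (int \<Rightarrow> real^2)" where
  "Mseq n U P 0 = (\<lambda>i. (1/2) *\<^sub>R (P i + P (i + int n)))"
| "Mseq n U P (Suc k) = InvN n U (InvM n U (Mseq n U P k))"

text \<open>N(k+1) = Inv(M(k)) (only meaningful for index k+1 >= 1).\<close>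
definition Nseq :: "nat \<Rightarrow> (int \<Rightarrow> real^2) \<Rightarrow> (int \<Rightarrow> real^2) \<Rightarrow> nat \<Rightarrow> (int \<Rightarrow> real^2)" where
  "Nseq n U P k = InvM n U (Mseq n U P (k - 1))"

definition polycurve :: "nat \<Rightarrow> (int \<Rightarrow> real^2) \<Rightarrow> (real^2) set" where
  "polycurve m X = (\<Union>i\<in>{0..<int m}. closed_segment (X i) (X (i+1)))"

text \<open>Exterior of the curve C relative to the reference set Pc (the curve P):
points joinable to a point of Pc by a path avoiding C; the region bounded by C is the
complement.\<close>
definition exterior_rel :: "(real^2) set \<Rightarrow> (real^2) set \<Rightarrow> (real^2) set" where
  "exterior_rel Pc C = {z. \<exists>g. path g \<and> pathstart g = z \<and> pathfinish g \<in> Pc \<and>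
                              path_image g \<inter> C = {}}"

definition region_rel :: "(real^2) set \<Rightarrow> (real^2) set \<Rightarrow> (real^2) set" where
  "region_rel Pc C = - exterior_rel Pc C"

end

(*
Let W 0 = U and let W (k+1) = Vvec (W k) be the dual polygon of W k. For a point x and the k-th
involute Z, h i = [x - Z i, W (k+1) i] measures the position of x relative to the line of the i-th
edge. These sequences change sign after half a period, and one involute step turns h into h' with
h' i - h' (i-1) = - A i * h i, where A i = [W k i, W k (i+1)] > 0; so h' never has more sign changes
than h.

Location of the centre. The vector sum of A i * h i * W (k+1) i over half a period is the same for all
involutes; the centre is the unique x where it vanishes. If h had a single sign change there, a
suitable linear functional would make all terms of that sum nonnegative, so h = 0 and x lies on the
curve. Off the curve, having a single sign change is an open and closed condition, and it holds on
P (for the central equidistant because the diameters separate the arcs of P, for later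
involutes by the previous paragraph). Hence the centre cannot be joined to P off the curve.

Convergence. Let E k be the sum of A i * (h i)^2. The discrete Wirtinger inequality makes E
decreasing, and its second differences are exactly the sums of A i * (b i)^2, with b i the lengths
used in the involute. So b tends to 0, the edges shrink to 0, and the conserved
vector sum forces the polygons to tend to the centre.
*)
theory Submission
  imports Defs
begin

section \<open>Determinants and sums over a period\<close>

lemma det2_simps:
  "det2 (x + y) z = det2 x z + det2 y z" "det2 x (y + z) = det2 x y + det2 x z"
  "det2 (x - y) z = det2 x z - det2 y z" "det2 x (y - z) = det2 x y - det2 x z"
  "det2 (r *\<^sub>R x) y = r * det2 x y" "det2 x (r *\<^sub>R y) = r * det2 x y"
  "det2 (- x) y = - det2 x y" "det2 x (- y) = - det2 x y"
  "det2 x x = 0" "det2 0 x = 0" "det2 x 0 = 0"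
  by (simp_all add: det2_def algebra_simps)

lemma det2_swap: "det2 x y = - det2 y x"
  by (simp add: det2_def)

lemma det2_sum_left: "det2 (\<Sum>i\<in>I. f i) y = (\<Sum>i\<in>I. det2 (f i) y)"
  by (induction I rule: infinite_finite_induct) (simp_all add: det2_simps)

lemma det2_sum_right: "det2 y (\<Sum>i\<in>I. f i) = (\<Sum>i\<in>I. det2 y (f i))"
  by (induction I rule: infinite_finite_induct) (simp_all add: det2_simps)

lemma det2_decompose: "det2 u v *\<^sub>R w = det2 w v *\<^sub>R u + det2 u w *\<^sub>R v"
  by (simp add: vec_eq_iff forall_2 det2_def algebra_simps)

lemma det2_eqI:
  assumes "det2 u v \<noteq> 0" "det2 w v = det2 w' v" "det2 u w = det2 u w'"
  shows "w = w'"
  by (metis assms det2_decompose scaleR_cancel_left)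

lemma abs_det2_le: "\<bar>det2 x y\<bar> \<le> norm x * norm y"
proof -
  \<comment> \<open>The determinant is the inner product with \<open>y\<close> rotated by a quarter
    turn, so Cauchy-Schwarz applies.\<close>
  have "det2 x y = x \<bullet> vector [y$2, - y$1]"
    by (simp add: det2_def inner_vec_def sum_2)
  moreover have "norm (vector [y$2, - y$1] :: real^2) = norm y"
    by (simp add: norm_vec_def L2_set_def sum_2 add.commute)
  ultimately show ?thesis
    by (metis Cauchy_Schwarz_ineq2)
qed

lemma continuous_on_det2 [continuous_intros]:
  "continuous_on S f \<Longrightarrow> continuous_on S g \<Longrightarrow> continuous_on S (\<lambda>x. det2 (f x) (g x))"
  unfolding det2_def by (intro continuous_intros)

lemma coef_scaleR: "d \<noteq> 0 \<Longrightarrow> coef (a *\<^sub>R d) d = a"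
  by (simp add: coef_def)

lemma sum_window_reindex:
  fixes m :: int
  shows "(\<Sum>j\<in>{m..<m'}. f (j + d)) = (\<Sum>j\<in>{m + d..<m' + d}. f j)"
  by (rule sum.reindex_bij_witness[of _ "\<lambda>j. j - d" "\<lambda>j. j + d"]) auto

lemma sum_window_Suc:
  fixes f :: "int \<Rightarrow> 'a::ab_group_add"
  shows "(\<Sum>j\<in>{m + 1..<m + 1 + int n}. f j) = (\<Sum>j\<in>{m..<m + int n}. f j) + f (m + int n) - f m"
proof -
  have "(\<Sum>j\<in>{m..<m + 1 + int n}. f j) = f m + (\<Sum>j\<in>{m + 1..<m + 1 + int n}. f j)"
  proof -
    have "{m..<m + 1 + int n} = insert m {m + 1..<m + 1 + int n}" by auto
    then show ?thesis by simp
  qed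
  moreover have "(\<Sum>j\<in>{m..<m + 1 + int n}. f j) = f (m + int n) + (\<Sum>j\<in>{m..<m + int n}. f j)"
  proof -
    have "{m..<m + 1 + int n} = insert (m + int n) {m..<m + int n}" by auto
    then show ?thesis by simp
  qed
  ultimately show ?thesis by (simp add: algebra_simps)
qed

lemma sum_window_telescope:
  fixes f :: "int \<Rightarrow> 'a::ab_group_add"
  shows "(\<Sum>j\<in>{m..<m + int n}. f (j + 1) - f j) = f (m + int n) - f m"
  using sum_window_Suc[of f m n] by (simp add: sum_subtractf sum_window_reindex algebra_simps)

lemma sum_window_periodic:
  fixes f :: "int \<Rightarrow> 'a::ab_group_add"
  assumes "\<And>i. f (i + int n) = f i"
  shows "(\<Sum>j\<in>{m..<m + int n}. f j) = (\<Sum>j\<in>{0..<int n}. f j)"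
proof (induction m rule: int_induct[where k = 0])
  case (step1 i) then show ?case using sum_window_Suc[of f i n] assms by simp
next
  case (step2 i) then show ?case using sum_window_Suc[of f "i - 1" n] assms[of "i-1"] by simp
qed simp

lemma sum_period_shift:
  fixes f :: "int \<Rightarrow> 'a::ab_group_add"
  assumes "\<And>i. f (i + int n) = f i"
  shows "(\<Sum>j\<in>{0..<int n}. f (j + d)) = (\<Sum>j\<in>{0..<int n}. f j)"
  using sum_window_periodic[of f n d, OF assms] by (simp add: sum_window_reindex add.commute)

lemma periodic_mod:
  fixes f :: "int \<Rightarrow> 'a"
  assumes "\<And>i. f (i + p) = f i"
  shows "f (i mod p) = f i"
proof -
  have "f (i + q * p) = f i" for i q
  proof (induction q rule: int_induct[where k = 0])
    case (step1 q) then show ?case using assms[of "i + q * p"] by (simp add: algebra_simps)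
  next
    case (step2 q) then show ?case using assms[of "i + (q - 1) * p"] by (simp add: algebra_simps)
  qed simp
  from this[of "i mod p" "i div p"] show ?thesis by simp
qed

section \<open>Sign changes of antiperiodic sequences\<close>

text \<open>For an antiperiodic sequence this says that a full period splits into a nonnegative and
  a nonpositive half. The weak inequality admits zeros and makes the condition closed.\<close>

definition one_sign :: "nat \<Rightarrow> (int \<Rightarrow> real) \<Rightarrow> bool" where
  "one_sign n h \<longleftrightarrow> (\<exists>m. \<forall>j\<in>{m..<m + int n}. h j \<ge> 0)"

text \<open>A discrete Rolle argument: on the window where \<open>h\<close> is nonnegative,
  \<open>g\<close> decreases from \<open>g (m - 1)\<close> to its negative. The entries after its
  last nonnegative one become nonnegative when moved back by \<open>n\<close>, and they adjoin the
  window on the left.\<close>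

lemma one_sign_step:
  assumes g_anti: "\<And>i. g (i + int n) = - g i" and "n > 0"
    and step: "\<And>i. g i - g (i - 1) = - (\<alpha> i * h i)" and \<alpha>: "\<And>i. \<alpha> i \<ge> 0"
    and h: "one_sign n h"
  shows "one_sign n g"
proof -
  obtain m where m: "\<And>j. m \<le> j \<Longrightarrow> j < m + int n \<Longrightarrow> h j \<ge> 0"
    using h unfolding one_sign_def by (meson atLeastLessThan_iff)
  have dec: "g (m - 1 + int b) \<le> g (m - 1 + int a)" if "a \<le> b" "b \<le> n" for a b
    using that
  proof (induction b rule: dec_induct)
    case (step b)
    have "g (m + int b) - g (m + int b - 1) \<le> 0"
      using assms(3)[of "m + int b"] \<alpha> m[of "m + int b"] step by simp
    then show ?case using step by (simp add: algebra_simps)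
  qed simp
  define K where "K = {k. k < n \<and> g (m - 1 + int k) \<ge> 0}"
  have "g (m - 1) \<ge> 0" using dec[of 0 n] g_anti[of "m-1"] by simp
  then have K: "finite K" "0 \<in> K" using \<open>n > 0\<close> by (auto simp: K_def)
  define k where "k = Max K"
  have "k \<in> K" unfolding k_def using K by (intro Max_in) auto
  moreover have "l \<le> k" if "l \<in> K" for l unfolding k_def using K(1) that by (rule Max_ge)
  ultimately have k: "k < n" "g (m - 1 + int k) \<ge> 0"
    "\<And>l. l < n \<Longrightarrow> g (m - 1 + int l) \<ge> 0 \<Longrightarrow> l \<le> k"
    by (auto simp: K_def)
  have "g j \<ge> 0" if "m + int k - int n \<le> j" "j < m + int k - int n + int n" for j
  proof (cases "j \<ge> m - 1")
    case True
    then have "nat (j - m + 1) \<le> k" "m - 1 + int (nat (j - m + 1)) = j" using that by auto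
    then show ?thesis using dec[of "nat (j - m + 1)" k] k by simp
  next
    case False
    then have "g (j + int n) < 0" using k(3)[of "nat (j + int n - m + 1)"] that by force
    then show ?thesis using g_anti[of j] by simp
  qed
  then show ?thesis unfolding one_sign_def by (intro exI[of _ "m + int k - int n"]) auto
qed

lemma segment_subset_polycurve:
  assumes "\<And>i. X (i + int m) = X i" "m > 0"
  shows "closed_segment (X i) (X (i + 1)) \<subseteq> polycurve m X"
proof -
  have "X (i mod int m) = X i" using assms(1) by (rule periodic_mod)
  moreover have "X (i + int m + 1) = X (i + 1)" for i
    using assms(1)[of "i + 1"] by (simp add: algebra_simps)
  then have "X (i mod int m + 1) = X (i + 1)" by (rule periodic_mod)
  moreover have "closed_segment (X (i mod int m)) (X (i mod int m + 1)) \<subseteq> polycurve m X"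
    unfolding polycurve_def using assms(2) by (intro UN_upper) simp
  ultimately show ?thesis by simp
qed

section \<open>Involutes with respect to a symmetric convex polygon\<close>

text \<open>The factor \<open>a\<close> may be zero or negative: edges of an involute may collapse
  or reverse, only their directions are prescribed.\<close>

definition admissible :: "nat \<Rightarrow> (int \<Rightarrow> real^2) \<Rightarrow> (int \<Rightarrow> real^2) \<Rightarrow> bool" where
  "admissible n U X \<longleftrightarrow> (\<forall>i. X (i + int n) = X i) \<and> (\<forall>i. \<exists>a. X (i+1) - X i = a *\<^sub>R (U (i+1) - U i))"

text \<open>The direction is taken from \<open>Vvec U i\<close> and not from the edge of
  \<open>X\<close>, so the value makes sense for a collapsed edge as well.\<close>

definition supp :: "(int \<Rightarrow> real^2) \<Rightarrow> (int \<Rightarrow> real^2) \<Rightarrow> real^2 \<Rightarrow> int \<Rightarrow> real" where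
  "supp U X x i = det2 (x - X i) (Vvec U i)"

text \<open>The assumptions are chosen so that the dual polygon satisfies them again; every result
  can then be used for all iterates of \<open>Vvec\<close>.\<close>

locale convex_sym =
  fixes n :: nat and U :: "int \<Rightarrow> real^2"
  assumes n2: "n \<ge> 2"
    and sym: "U (i + int n) = - U i"
    and convex: "j mod (2 * int n) \<noteq> i mod (2 * int n) \<Longrightarrow> j mod (2 * int n) \<noteq> (i + 1) mod (2 * int n) \<Longrightarrow>
                 det2 (U (i+1) - U i) (U j - U i) > 0"
begin

abbreviation V where "V \<equiv> Vvec U"
abbreviation A where "A i \<equiv> det2 (U i) (U (i + 1))"
abbreviation B where "B i \<equiv> det2 (V i) (V (i + 1))"

lemma mod_neq: "\<lbrakk>j \<noteq> i; \<bar>j - i\<bar> < 2 * int n\<rbrakk> \<Longrightarrow> j mod (2 * int n) \<noteq> i mod (2 * int n)"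
  using zdvd_imp_le[of "2 * int n" "\<bar>j - i\<bar>"] by (auto simp: mod_eq_dvd_iff)

section \<open>Positivity and duality of the polygons U and V\<close>

lemma A_pos: "A i > 0"
proof -
  \<comment> \<open>Convexity is applied to the vertex \<open>- U i\<close> opposite to
    \<open>U i\<close>.\<close>
  have "det2 (U (i+1) - U i) (U (i + int n) - U i) > 0"
    using n2 by (intro convex mod_neq) auto
  then have "2 * A i > 0"
    using det2_swap[of "U (i+1)" "U i"] by (simp only: sym det2_simps)
  then show ?thesis by simp
qed

lemma edge: "U (i + 1) - U i = A i *\<^sub>R V i"
  using A_pos[of i] by (simp add: Vvec_def)

lemma V_sym: "V (i + int n) = - V i"
  using sym[of "i + 1"] sym[of i]
  by (simp add: Vvec_def det2_simps add.commute add.left_commute scaleR_diff_right)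

lemma det_UV: "det2 (U i) (V i) = 1" and det_UV': "det2 (U (i+1)) (V i) = 1"
  using A_pos[of i] det2_swap[of "U (i+1)" "U i"] by (simp_all add: Vvec_def det2_simps)

lemma det_VU: "det2 (V i) (U i) = -1" and det_VU': "det2 (V i) (U (i+1)) = -1"
  using det_UV det_UV' det2_swap by metis+

lemma B_pos: "B i > 0"
proof -
  have "det2 (U (i+2) - U (i+1)) (U i - U (i+1)) > 0"
    using n2 convex[of i "i+1"] mod_neq[of i "i+1"] mod_neq[of i "i+2"] by (simp add: add.assoc)
  moreover have "U (i+2) - U (i+1) = A (i+1) *\<^sub>R V (i+1)" "U i - U (i+1) = - (A i *\<^sub>R V i)"
    using edge[of "i+1"] edge[of i] minus_diff_eq[of "U (i+1)" "U i"] by (simp_all add: add.assoc)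
  ultimately have "A (i+1) * A i * B i > 0"
    using det2_swap[of "V (i+1)" "V i"] by (simp add: det2_simps add.assoc mult.assoc mult.left_commute)
  then show ?thesis using A_pos by (metis mult_pos_pos zero_less_mult_pos)
qed

text \<open>\<open>V i\<close> and \<open>V (i + 1)\<close> have the same determinant with
  \<open>U (i + 1)\<close>, so their difference is a multiple of it; pairing with \<open>V i\<close>
  gives the factor.\<close>

lemma V_edge: "V (i + 1) - V i = - (B i *\<^sub>R U (i+1))"
  using det_UV'[of i] det_UV[of "i+1"] det_VU'[of i]
  by (intro det2_eqI[of "V i" "U (i+1)"]) (simp_all add: det2_simps det2_swap[of _ "U (i+1)"])

text \<open>Duality is an involution up to a sign. The index shift comes from dropping one half in
  the encoding at each of the two steps.\<close>

lemma Vvec_V: "Vvec V i = - U (i+1)"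
  using B_pos[of i] by (simp add: Vvec_def[of V] V_edge)

lemma det_VU_gt:
  assumes "j mod (2 * int n) \<noteq> i mod (2 * int n)" "j mod (2 * int n) \<noteq> (i + 1) mod (2 * int n)"
  shows "det2 (V i) (U j) > -1"
proof -
  have "A i * (det2 (V i) (U j) + 1) > 0"
    using convex[OF assms] unfolding edge by (simp add: det2_simps det_VU algebra_simps)
  then show ?thesis using A_pos[of i] by (simp add: zero_less_mult_iff)
qed

lemma det_VU_ge: "det2 (V i) (U j) \<ge> -1"
proof -
  have "U (a + 2 * int n) = U a" for a
    using sym[of a] sym[of "a + int n"] by (simp add: algebra_simps)
  then have eq: "U a = U b" if "a mod (2 * int n) = b mod (2 * int n)" for a b
    using that periodic_mod[of U "2 * int n"] by metis
  show ?thesis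
    using det_VU_gt[of j i] eq[of j i] eq[of j "i+1"] det_VU det_VU' by (cases "j mod (2 * int n) = i mod (2 * int n)"; cases "j mod (2 * int n) = (i + 1) mod (2 * int n)") force+
qed

text \<open>By \<open>V_edge\<close> the convexity determinant of \<open>V\<close> at edge
  \<open>i\<close> and vertex \<open>j\<close> is \<open>B i * (det2 (V j) (U (i+1)) + 1)\<close>,
  which is convexity of \<open>U\<close> at edge \<open>j\<close> and vertex \<open>i + 1\<close>:
  duality swaps edges and vertices.\<close>

lemma convex_sym_dual: "convex_sym n V"
proof
  show "n \<ge> 2" by (rule n2)
  show "V (i + int n) = - V i" for i by (rule V_sym)
  fix i j :: int
  assume *: "j mod (2 * int n) \<noteq> i mod (2 * int n)" "j mod (2 * int n) \<noteq> (i + 1) mod (2 * int n)"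
  have "(i + 1) mod (2 * int n) \<noteq> (j + 1) mod (2 * int n)"
    using * by (simp add: mod_eq_dvd_iff dvd_diff_commute)
  then have "det2 (V j) (U (i+1)) > -1" using * by (intro det_VU_gt) simp_all
  then show "det2 (V (i + 1) - V i) (V j - V i) > 0"
    using mult_pos_pos[OF B_pos[of i], of "det2 (V j) (U (i+1)) + 1"] det_UV'[of i] det2_swap[of "U (i+1)" "V j"]
    unfolding V_edge by (simp add: det2_simps algebra_simps)
qed

text \<open>Local left turns do not by themselves exclude turning by more than a half turn over
  \<open>n - 1\<close> steps. Convexity does: \<open>det2 (V i)\<close>, viewed as a height, equals
  1 only at the two ends of the edge opposite to edge \<open>i\<close>, and a premature sign change
  would force another vertex up to that height.\<close>

lemma det_V_pos:
  assumes "i < j" "j < i + int n"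
  shows "det2 (V i) (V j) > 0"
proof -
  have "det2 (V i) (V (i + int k)) > 0" if "0 < k" "k < n" for k
    using that
  proof (induction k)
    case (Suc l)
    show ?case
    proof (cases "l = 0")
      case True
      then show ?thesis using B_pos by simp
    next
      case False
      define j where "j = i + int (Suc l)"
      have j1: "j - 1 = i + int l" by (simp add: j_def)
      have e: "det2 (V i) (V (j - 1)) > 0" using Suc False by (simp add: j1)
      show ?thesis
      proof (rule ccontr)
        assume "\<not> ?thesis"
        then have e': "det2 (V i) (V j) \<le> 0" by (simp add: j_def)
        \<comment> \<open>The vector from \<open>U j\<close> to a vertex at height 1. Convexity at
          the two edges meeting in \<open>U j\<close> gives the signs of its coordinates in the
          basis \<open>V (j-1)\<close>, \<open>V j\<close>, hence it cannot point upwards.\<close>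
        define w where "w = U (i + int n) - U j"
        have w1: "det2 (V (j-1)) w \<ge> 0"
          using det_VU_ge[of "j-1" "i + int n"] det_VU'[of "j-1"] by (simp add: w_def det2_simps)
        have w2: "det2 (V j) w \<ge> 0"
          using det_VU_ge[of "j" "i + int n"] det_VU[of j] by (simp add: w_def det2_simps)
        have "B (j-1) * det2 (V i) w = det2 w (V j) * det2 (V i) (V (j-1)) + det2 (V (j-1)) w * det2 (V i) (V j)"
          using arg_cong[OF det2_decompose[of "V (j-1)" "V j" w], of "det2 (V i)"] by (simp add: det2_simps)
        also have "\<dots> \<le> 0"
          using w1 w2 e e' det2_swap[of w "V j"]
          by (intro add_nonpos_nonpos) (simp_all add: mult_nonneg_nonpos)
        finally have "det2 (V i) w \<le> 0"
          using B_pos[of "j-1"] by (simp add: mult_le_0_iff)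
        then have "det2 (V i) (U j) \<ge> 1" by (simp add: w_def det2_simps sym det_VU)
        moreover have "det2 (V i) (U (j + int n)) > -1"
          using Suc.prems False by (intro det_VU_gt mod_neq) (auto simp: j_def)
        ultimately show False by (simp add: sym det2_simps)
      qed
    qed
  qed simp
  from this[of "nat (j - i)"] show ?thesis using assms by simp
qed

lemma det_U_pos:
  assumes "i < j" "j < i + int n"
  shows "det2 (U i) (U j) > 0"
  using convex_sym.det_V_pos[OF convex_sym_dual, of "i-1" "j-1"] assms
  by (simp add: Vvec_V det2_simps)

text \<open>This is the length \<open>b_i\<close> of the involute, read off by pairing with
  \<open>U i\<close> because \<open>det2 (U i) (V i) = 1\<close>.\<close>

definition offset :: "(int \<Rightarrow> real^2) \<Rightarrow> int \<Rightarrow> real" where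
  "offset X i = det2 (U i) (InvM n U X i - X i)"

text \<open>The summands \<open>f\<close> are antiperiodic, so moving the half-period window by one
  changes its sum by \<open>- 2 * f i\<close>. With the factor 1/2 the involute point on line
  \<open>i\<close> is the same whether measured from \<open>X i\<close> or from
  \<open>X (i + 1)\<close>.\<close>

lemma
  assumes "admissible n U X"
  shows offset_anti: "offset X (i + int n) = - offset X i"
    and InvM_offset: "InvM n U X i = X i + offset X i *\<^sub>R V i"
    and InvM_offset': "InvM n U X i = X (i + 1) + offset X (i + 1) *\<^sub>R V i"
    and edge_offset: "X (i + 1) - X i = (offset X i - offset X (i + 1)) *\<^sub>R V i"
proof -
  obtain a where a: "\<And>i. X (i+1) - X i = a i *\<^sub>R (U (i+1) - U i)"
    using assms unfolding admissible_def by metis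
  have per: "X (i + int n) = X i" for i using assms by (simp add: admissible_def)
  have ne: "U (i+1) - U i \<noteq> 0" for i
    using A_pos[of i] by (auto simp: det2_simps)
  have co: "coef (X (i+1) - X i) (U (i+1) - U i) = a i" for i
    unfolding a by (rule coef_scaleR[OF ne])
  define f where "f j = a j * A j" for j
  define b where "b i = (1/2) * (\<Sum>j\<in>{i..<i + int n}. f j)" for i
  have f_anti: "f (i + int n) = - f i" for i
  proof -
    have "U (i + int n + 1) = - U (i+1)" using sym[of "i+1"] by (simp add: algebra_simps)
    moreover have "X (i + int n + 1) = X (i+1)" using per[of "i+1"] by (simp add: algebra_simps)
    ultimately have "a (i + int n) *\<^sub>R (- (U (i+1) - U i)) = a i *\<^sub>R (U (i+1) - U i)"
      using a[of "i + int n"] a[of i] by (simp add: sym per)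
    then have "(a (i + int n) + a i) *\<^sub>R (U (i+1) - U i) = 0"
      by (simp add: scaleR_add_left algebra_simps)
    then have "a (i + int n) = - a i" using ne[of i] by simp
    then show ?thesis
      using \<open>U (i + int n + 1) = - U (i+1)\<close> by (simp add: f_def sym det2_simps)
  qed
  have b_step: "b (i + 1) = b i - f i" for i
    unfolding b_def using sum_window_Suc[of f i n] f_anti[of i] by (simp add: field_simps)
  have Y: "InvM n U X i = X i + b i *\<^sub>R V i" for i
  proof -
    have "{i..i + int n - 1} = {i..<i + int n}" by auto
    then show ?thesis by (simp add: InvM_def Let_def co b_def f_def)
  qed
  have d: "X (i + 1) - X i = (b i - b (i + 1)) *\<^sub>R V i" for i
    by (simp add: a edge b_step f_def)
  have b_anti: "b (i + int n) = - b i" for i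
  proof -
    have "(\<Sum>j\<in>{i..<i + int n}. f (j + int n)) = (\<Sum>j\<in>{i + int n..<i + int n + int n}. f j)"
      by (rule sum_window_reindex)
    then show ?thesis by (simp add: b_def f_anti sum_negf)
  qed
  have off: "offset X i = b i" for i
    by (simp add: offset_def Y det2_simps det_UV)
  show "offset X (i + int n) = - offset X i" "InvM n U X i = X i + offset X i *\<^sub>R V i"
    "X (i + 1) - X i = (offset X i - offset X (i + 1)) *\<^sub>R V i"
    by (simp_all add: off b_anti Y d)
  show "InvM n U X i = X (i + 1) + offset X (i + 1) *\<^sub>R V i"
    using d[of i] by (simp add: Y off algebra_simps)
qed

text \<open>Two consecutive points of the involute are measured from their common vertex
  \<open>X (i + 1)\<close> with the same length, so only the directions \<open>V i\<close> and
  \<open>V (i + 1)\<close> differ.\<close>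

lemma admissible_InvM:
  assumes "admissible n U X"
  shows "admissible n V (InvM n U X)"
proof -
  note b = offset_anti[OF assms] InvM_offset[OF assms] InvM_offset'[OF assms]
  have "X (i + int n) = X i" for i using assms by (simp add: admissible_def)
  then have "InvM n U X (i + int n) = InvM n U X i" for i
    by (simp add: b(2) b(1) V_sym)
  moreover have "InvM n U X (i + 1) - InvM n U X i = offset X (i+1) *\<^sub>R (V (i+1) - V i)" for i
    using b(2)[of "i+1"] b(3)[of i] by (simp add: scaleR_diff_right)
  ultimately show ?thesis unfolding admissible_def by blast
qed

section \<open>Position of a point relative to the edge lines\<close>

lemma supp_anti:
  assumes "admissible n U X"
  shows "supp U X x (i + int n) = - supp U X x i"
  using assms by (simp add: admissible_def supp_def V_sym det2_simps)

lemma supp_eq: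
  assumes "admissible n U X"
  shows "supp U X x i = det2 (x - X (i + 1)) (V i)"
proof -
  obtain a where "X (i+1) = X i + a *\<^sub>R (U (i+1) - U i)"
    using assms unfolding admissible_def by (metis add_diff_cancel_left' diff_add_cancel add.commute)
  then show ?thesis unfolding edge by (simp add: supp_def det2_simps)
qed

text \<open>Both involute points are measured from \<open>X i\<close> with the same length, and its
  two contributions cancel since \<open>V i\<close> with \<open>U (i + 1)\<close> and
  \<open>V (i - 1)\<close> with \<open>U i\<close> have the same determinant. Only the edge of
  \<open>U\<close> remains.\<close>

lemma supp_InvM:
  assumes "admissible n U X"
  shows "supp V (InvM n U X) x i - supp V (InvM n U X) x (i - 1) = - (A i * supp U X x i)"
proof -
  note b = InvM_offset[OF assms] InvM_offset'[OF assms]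
  have "supp V (InvM n U X) x i - supp V (InvM n U X) x (i - 1) = - det2 (x - X i) (U (i+1) - U i)"
    using b(1)[of i] b(2)[of "i-1"] det_VU'[of i] det_VU'[of "i-1"]
    by (simp add: supp_def Vvec_V det2_simps algebra_simps)
  then show ?thesis by (simp add: edge det2_simps supp_def)
qed

section \<open>Points with a single sign change\<close>

text \<open>Here \<open>x\<close> lies on the line of the edge but outside the edge, so
  \<open>x - X j\<close> and \<open>x - X (j + 1)\<close> are multiples of \<open>V j\<close> with
  factors of equal sign. The neighbouring lines pass through these two vertices and turn to opposite
  sides.\<close>

lemma supp_zero_neighbours:
  assumes X: "admissible n U X" and z: "supp U X x j = 0"
    and x: "x \<notin> closed_segment (X j) (X (j + 1))"
  shows "supp U X x (j - 1) * supp U X x (j + 1) < 0"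
proof -
  define s where "s = det2 (x - X j) (V (j+1)) / B j"
  define r where "r = offset X j - offset X (j + 1)"
  have "B j *\<^sub>R (x - X j) = det2 (x - X j) (V (j+1)) *\<^sub>R V j"
    using det2_decompose[of "V j" "V (j+1)" "x - X j"] z det2_swap[of "V j" "x - X j"]
    by (simp add: supp_def)
  then have "B j *\<^sub>R (x - X j) = B j *\<^sub>R (s *\<^sub>R V j)"
    using B_pos[of j] by (simp add: s_def)
  then have xs: "x - X j = s *\<^sub>R V j"
    using B_pos[of j] by (metis less_irrefl scaleR_cancel_left)
  have Xr: "X (j + 1) - X j = r *\<^sub>R V j" unfolding r_def by (rule edge_offset[OF X])
  have "s * (s - r) > 0"
  proof (rule ccontr)
    assume "\<not> ?thesis"
    then have le: "s * (s - r) \<le> 0" by simp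
    have "\<exists>t. 0 \<le> t \<and> t \<le> 1 \<and> s = t * r"
    proof (cases "r = 0")
      case True then show ?thesis using le by (auto simp: mult_le_0_iff intro!: exI[of _ 0])
    next
      case False
      then show ?thesis using le
        by (intro exI[of _ "s / r"]) (auto simp: mult_le_0_iff divide_simps)
    qed
    then obtain t where t: "0 \<le> t" "t \<le> 1" "s = t * r" by blast
    have "t *\<^sub>R (X (j+1) - X j) = x - X j" by (simp add: Xr xs t(3))
    then have "x = X j + t *\<^sub>R (X (j+1) - X j)" by simp
    then have "x = (1 - t) *\<^sub>R X j + t *\<^sub>R X (j + 1)" by (simp add: algebra_simps)
    then show False using x t by (auto simp: closed_segment_def)
  qed
  moreover have "supp U X x (j - 1) = - (s * B (j - 1))"
    using supp_eq[OF X, of x "j - 1"] det2_swap[of "V j" "V (j-1)"] by (simp add: xs det2_simps)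
  moreover have "x - X (j+1) = (s - r) *\<^sub>R V j" using xs Xr by (simp add: algebra_simps)
  then have "supp U X x (j + 1) = (s - r) * B j"
    by (simp add: supp_def det2_simps)
  ultimately have "supp U X x (j - 1) * supp U X x (j + 1) = - ((s * (s - r)) * (B (j-1) * B j))"
    by simp
  then show ?thesis
    using mult_pos_pos[OF \<open>s * (s - r) > 0\<close> mult_pos_pos[OF B_pos[of "j-1"] B_pos[of j]]] by simp
qed

text \<open>A closed condition equals an open one off the curve: there \<open>supp\<close> takes values of opposite
  signs on both sides of a zero, so a zero can only sit at an end of the nonnegative window.\<close>
lemma one_sign_off_curve:
  assumes X: "admissible n U X" and x: "x \<notin> polycurve (2 * n) X"
  shows "one_sign n (supp U X x) \<longleftrightarrow> (\<exists>m. \<forall>j\<in>{m<..<m + int n}. supp U X x j > 0)"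
proof
  have anti: "supp U X x (i + int n) = - supp U X x i" for i by (rule supp_anti[OF X])
  have per: "X (i + int n) = X i" for i using X by (simp add: admissible_def)
  have per2: "X (i + int (2 * n)) = X i" for i
    using per[of i] per[of "i + int n"] by (simp add: algebra_simps)
  have nz: "supp U X x (j - 1) * supp U X x (j + 1) < 0" if "supp U X x j = 0" for j
    using supp_zero_neighbours[OF X that] segment_subset_polycurve[of X "2 * n" j, OF per2] x n2 by auto
  {
    assume "\<exists>m. \<forall>j\<in>{m<..<m + int n}. supp U X x j > 0"
    then obtain m where m: "\<And>j. m < j \<Longrightarrow> j < m + int n \<Longrightarrow> supp U X x j > 0"
      by (meson greaterThanLessThan_iff)
    show "one_sign n (supp U X x)"
    \<comment> \<open>The entries at \<open>m\<close> and \<open>m + int n\<close> are opposite, so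
      one of them is nonnegative and completes the \<open>n - 1\<close> positive entries.\<close>
    proof (cases "supp U X x m \<ge> 0")
      case True
      then have "\<forall>j\<in>{m..<m + int n}. supp U X x j \<ge> 0" using m by (force simp: le_less)
      then show ?thesis unfolding one_sign_def by blast
    next
      case False
      then have "supp U X x (m + int n) \<ge> 0" using anti[of m] by simp
      moreover have "j = m + int n \<or> j < m + int n" if "j < m + 1 + int n" for j using that by auto
      ultimately have "\<forall>j\<in>{m + 1..<m + 1 + int n}. supp U X x j \<ge> 0" using m by (force simp: le_less)
      then show ?thesis unfolding one_sign_def by blast
    qed
  next
    assume "one_sign n (supp U X x)"
    then obtain m where m: "\<And>j. m \<le> j \<Longrightarrow> j < m + int n \<Longrightarrow> supp U X x j \<ge> 0"
      unfolding one_sign_def by (meson atLeastLessThan_iff)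
    have int: "supp U X x j > 0" if "m < j" "j < m + int n - 1" for j
    proof (rule ccontr)
      assume "\<not> ?thesis"
      then have "supp U X x j = 0" using m[of j] that by simp
      from nz[OF this] m[of "j-1"] m[of "j+1"] that show False
        by (simp add: mult_less_0_iff)
    qed
    show "\<exists>m. \<forall>j\<in>{m<..<m + int n}. supp U X x j > 0"
    proof (cases "supp U X x (m + int n - 1) = 0")
      case False
      then have "supp U X x (m + int n - 1) > 0" using m[of "m + int n - 1"] n2 by simp
      then have "supp U X x j > 0" if "m < j" "j < m + int n" for j
        using int[of j] that by (cases "j = m + int n - 1") auto
      then show ?thesis by (intro exI[of _ m]) auto
    next
      case True
      \<comment> \<open>A zero at the right end recurs just before the left end, so the entry at
        \<open>m\<close> is nonzero and the window can be moved back by one.\<close>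
      then have "supp U X x (m - 1) = 0" using anti[of "m - 1"] by (simp add: algebra_simps)
      then have "supp U X x m \<noteq> 0" using nz[of "m - 1"] by auto
      then have "supp U X x m > 0" using m[of m] n2 by simp
      then have "supp U X x j > 0" if "m - 1 < j" "j < m - 1 + int n" for j
        using int[of j] that by (cases "j = m") auto
      then show ?thesis by (intro exI[of _ "m - 1"]) auto
    qed
  }
qed

lemma continuous_on_supp: "continuous_on S (\<lambda>x. supp U X x j)"
  unfolding supp_def by (intro continuous_intros)

text \<open>Periodicity leaves finitely many windows, so the union of closed sets is finite.\<close>

lemma closed_one_sign:
  assumes X: "admissible n U X"
  shows "closed {x. one_sign n (supp U X x)}"
proof -
  have per: "supp U X x (i + 2 * int n) = supp U X x i" for x i
    using supp_anti[OF X, of x i] supp_anti[OF X, of x "i + int n"] by (simp add: algebra_simps)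
  have "one_sign n (supp U X x) \<longleftrightarrow> (\<exists>m\<in>{0..<2 * int n}. \<forall>k\<in>{0..<int n}. supp U X x (m + k) \<ge> 0)" for x
  proof
    assume "one_sign n (supp U X x)"
    then obtain m where m: "\<And>j. m \<le> j \<Longrightarrow> j < m + int n \<Longrightarrow> supp U X x j \<ge> 0"
      unfolding one_sign_def by (meson atLeastLessThan_iff)
    have "supp U X x (i + 2 * int n + k) = supp U X x (i + k)" for i k
      using per[of x "i + k"] by (simp add: algebra_simps)
    then have "supp U X x (m mod (2 * int n) + k) = supp U X x (m + k)" for k
      by (rule periodic_mod)
    then show "\<exists>m\<in>{0..<2 * int n}. \<forall>k\<in>{0..<int n}. supp U X x (m + k) \<ge> 0"
      using m n2 by (intro bexI[of _ "m mod (2 * int n)"]) auto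
  next
    assume "\<exists>m\<in>{0..<2 * int n}. \<forall>k\<in>{0..<int n}. supp U X x (m + k) \<ge> 0"
    then obtain m where m: "\<And>k. 0 \<le> k \<Longrightarrow> k < int n \<Longrightarrow> supp U X x (m + k) \<ge> 0"
      by (meson atLeastLessThan_iff)
    have "supp U X x j \<ge> 0" if "j \<in> {m..<m + int n}" for j using m[of "j - m"] that by simp
    then show "one_sign n (supp U X x)" unfolding one_sign_def by blast
  qed
  then have "{x. one_sign n (supp U X x)} =
      (\<Union>m\<in>{0..<2 * int n}. \<Inter>k\<in>{0..<int n}. {x. 0 \<le> supp U X x (m + k)})"
    by auto
  then show ?thesis
    by (simp add: closed_UN closed_INT closed_Collect_le continuous_on_supp)
qed

lemma open_pos_window: "open {x. \<exists>m. \<forall>j\<in>{m<..<m + int n}. supp U X x j > 0}"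
proof -
  have "{x. \<exists>m. \<forall>j\<in>{m<..<m + int n}. supp U X x j > 0} =
      (\<Union>m. \<Inter>j\<in>{m<..<m + int n}. {x. 0 < supp U X x j})"
    by auto
  then show ?thesis
    by (simp add: open_UN open_INT open_Collect_less continuous_on_supp)
qed

text \<open>For admissible \<open>X\<close> the summand is \<open>n\<close>-periodic, so any half
  period gives the same vector.\<close>

definition moment :: "(int \<Rightarrow> real^2) \<Rightarrow> real^2 \<Rightarrow> real^2" where
  "moment X x = (\<Sum>i\<in>{0..<int n}. (A i * supp U X x i) *\<^sub>R V i)"

lemma one_sign_moment_zero:
  assumes X: "admissible n U X" and os: "one_sign n (supp U X x)" and mom: "moment X x = 0"
  shows "supp U X x i = 0"
proof -
  define h where "h = supp U X x"
  obtain m where m: "\<And>j. m \<le> j \<Longrightarrow> j < m + int n \<Longrightarrow> h j \<ge> 0"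
    using os unfolding one_sign_def h_def by (meson atLeastLessThan_iff)
  \<comment> \<open>\<open>V m\<close> alone gives zero at the first index of the window and
    \<open>V (m - 1)\<close> alone at the last; their sum is strictly positive on all of it.\<close>
  define y where "y = V (m - 1) + V m"
  have y: "det2 y (V j) > 0" if "m \<le> j" "j < m + int n" for j
  proof -
    have "det2 (V (m-1)) (V j) \<ge> 0"
    proof (cases "j = m + int n - 1")
      case True
      then have "V j = - V (m - 1)" using V_sym[of "m-1"] by (simp add: diff_add_eq)
      then show ?thesis by (simp add: det2_simps)
    qed (use that det_V_pos[of "m-1" j] in auto)
    moreover have "det2 (V m) (V j) \<ge> 0"
      using that det_V_pos[of m j] by (cases "j = m") (auto simp: det2_simps)
    moreover have "det2 (V (m-1)) (V j) > 0 \<or> det2 (V m) (V j) > 0"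
      using that det_V_pos[of m j] B_pos[of "m-1"] by (cases "j = m") auto
    ultimately show ?thesis by (auto simp: y_def det2_simps)
  qed
  have "(A (j + int n) * h (j + int n)) * det2 y (V (j + int n)) = (A j * h j) * det2 y (V j)" for j
    using sym[of "j+1"] sym[of j] supp_anti[OF X, of x j]
    by (simp add: h_def V_sym det2_simps algebra_simps)
  then have "(\<Sum>j\<in>{m..<m + int n}. (A j * h j) * det2 y (V j)) = (\<Sum>j\<in>{0..<int n}. (A j * h j) * det2 y (V j))"
    by (rule sum_window_periodic)
  also have "\<dots> = det2 y (moment X x)"
    by (simp add: moment_def det2_sum_right det2_simps h_def)
  finally have "(\<Sum>j\<in>{m..<m + int n}. (A j * h j) * det2 y (V j)) = 0"
    by (simp add: mom det2_simps)
  then have "\<forall>j\<in>{m..<m + int n}. (A j * h j) * det2 y (V j) = 0"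
    using m y A_pos by (subst (asm) sum_nonneg_eq_0_iff) (auto simp: less_imp_le)
  then have z: "h j = 0" if "m \<le> j" "j < m + int n" for j
    using y[OF that] A_pos[of j] that by (metis atLeastLessThan_iff less_irrefl mult_eq_0_iff)
  have "\<bar>h (m + (i - m) mod int n)\<bar> = \<bar>h (m + (i - m))\<bar>"
    using supp_anti[OF X, of x] periodic_mod[of "\<lambda>i. \<bar>h (m + i)\<bar>" "int n" "i - m"]
    by (simp add: h_def add.assoc[symmetric])
  moreover have "h (m + (i - m) mod int n) = 0" using n2 by (intro z) auto
  ultimately show ?thesis by (simp add: h_def)
qed

lemma moment_zero_in_region:
  assumes X: "admissible n U X" and os: "\<And>p. p \<in> Pc \<Longrightarrow> one_sign n (supp U X p)"
    and mom: "moment X x = 0"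
  shows "x \<in> region_rel Pc (polycurve (2 * n) X)"
proof (rule ccontr)
  define D where "D = {x. one_sign n (supp U X x)}"
  define E where "E = {x. \<exists>m. \<forall>j\<in>{m<..<m + int n}. supp U X x j > 0}"
  assume "\<not> ?thesis"
  then obtain g where g: "path g" "pathstart g = x" "pathfinish g \<in> Pc"
    "path_image g \<inter> polycurve (2 * n) X = {}"
    by (auto simp: region_rel_def exterior_rel_def)
  define S where "S = path_image g"
  \<comment> \<open>Off the curve the closed condition \<open>D\<close> and the open condition
    \<open>E\<close> agree, so \<open>D\<close> is clopen in the connected path.\<close>
  have "S \<inter> D = S \<inter> E"
    using g(4) one_sign_off_curve[OF X] by (auto simp: S_def D_def E_def)
  then have "openin (top_of_set S) (S \<inter> D) \<and> closedin (top_of_set S) (S \<inter> D)"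
    using closed_one_sign[OF X] open_pos_window[of X]
    by (metis D_def E_def closedin_closed_Int openin_open_Int)
  then have "S \<inter> D = {} \<or> S \<inter> D = S"
    using connected_path_image[OF g(1)] unfolding S_def connected_clopen by blast
  moreover have "pathfinish g \<in> S \<inter> D" using os[OF g(3)] by (simp add: S_def D_def pathfinish_in_path_image)
  moreover have "x \<in> S" using g(2) by (auto simp: S_def pathstart_in_path_image)
  ultimately have "one_sign n (supp U X x)" by (auto simp: D_def)
  from one_sign_moment_zero[OF X this mom] have z: "supp U X x i = 0" for i .
  \<comment> \<open>With all positions zero, \<open>x\<close> lies on the two lines meeting at the
    vertex \<open>X 0\<close>, which is on the curve.\<close>
  have "x - X 0 = 0"
    using z[of 0] z[of "-1"] supp_eq[OF X, of x "-1"] B_pos[of "-1"] det2_swap[of "V (-1)" "x - X 0"]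
    by (intro det2_eqI[of "V (-1)" "V 0"]) (simp_all add: supp_def det2_simps)
  moreover have "X 0 \<in> polycurve (2 * n) X"
    using n2 by (auto simp: polycurve_def intro!: bexI[of _ 0])
  ultimately show False using g(4) \<open>x \<in> S\<close> by (auto simp: S_def)
qed

section \<open>The Wirtinger inequality and the energy\<close>

text \<open>By Picone's identity with the comparison sequence \<open>u i = [U 0, U i]\<close>.\<close>
lemma wirtinger_vanishing:
  assumes f: "f 0 = 0" "f (int n) = 0"
  shows "(\<Sum>i\<in>{0..<int n}. B (i - 1) * (f i)\<^sup>2) \<le> (\<Sum>i\<in>{0..<int n}. (f (i + 1) - f i)\<^sup>2 / A i)"
proof -
  define u where "u i = det2 (U 0) (U i)" for i
  define v where "v i = det2 (U 0) (V i)" for i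
  \<comment> \<open>At \<open>0\<close> and \<open>int n\<close> both \<open>f\<close> and
    \<open>u\<close> vanish, and the convention for division by zero gives \<open>F\<close> the
    fitting value 0.\<close>
  define F where "F i = (f i)\<^sup>2 / u i" for i
  have u_pos: "u i > 0" if "0 < i" "i < int n" for i
    using det_U_pos[of 0 i] that by (simp add: u_def)
  have u0: "u 0 = 0" by (simp add: u_def det2_simps)
  have un: "u (int n) = 0" using sym[of 0] by (simp add: u_def det2_simps)
  have du: "u (i + 1) - u i = A i * v i" for i
    using arg_cong[OF edge[of i], of "det2 (U 0)"] by (simp add: u_def v_def det2_simps)
  have dv: "v i - v (i - 1) = - (B (i - 1) * u i)" for i
    using arg_cong[OF V_edge[of "i - 1"], of "det2 (U 0)"] by (simp add: u_def v_def det2_simps)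
  \<comment> \<open>At the first and last index one end of \<open>u\<close> vanishes and equality
    holds; in between the deficit is the square
    \<open>u i * u (i + 1) * (q - p)\<^sup>2\<close>.\<close>
  have pt: "v i * (F (i + 1) - F i) \<le> (f (i + 1) - f i)\<^sup>2 / A i" if "0 \<le> i" "i < int n" for i
  proof -
    consider "i = 0" | "i = int n - 1" "i \<noteq> 0" | "0 < i" "i + 1 < int n" using \<open>0 \<le> i\<close> \<open>i < int n\<close> by linarith
    then show ?thesis
    proof cases
      case 1
      have "u 1 > 0" using n2 by (intro u_pos) auto
      then show ?thesis
        using du[of 0] A_pos[of 0] by (simp add: 1 F_def f u0 field_simps)
    next
      case 2
      have "u i > 0" using that 2 by (intro u_pos) auto
      have "u (i + 1) = 0" "f (i + 1) = 0" using 2(1) un f by simp_all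
      moreover have "v i = - (u i / A i)"
        using du[of i] \<open>u (i + 1) = 0\<close> A_pos[of i] by (simp add: field_simps)
      ultimately show ?thesis using \<open>u i > 0\<close> by (simp add: F_def)
    next
      case 3
      define p where "p = f i / u i"
      define q where "q = f (i + 1) / u (i + 1)"
      have pos: "u i > 0" "u (i + 1) > 0" using 3 by (auto intro!: u_pos)
      have fp: "f i = p * u i" "f (i + 1) = q * u (i + 1)" using pos by (auto simp: p_def q_def)
      have "A i * (v i * (F (i + 1) - F i)) = (u (i+1) - u i) * (q\<^sup>2 * u (i+1) - p\<^sup>2 * u i)"
        using pos by (simp add: du F_def fp power2_eq_square)
      also have "\<dots> = (f (i + 1) - f i)\<^sup>2 - u i * u (i + 1) * (q - p)\<^sup>2"
        unfolding fp power2_eq_square by (simp add: algebra_simps)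
      also have "\<dots> \<le> (f (i + 1) - f i)\<^sup>2" using pos by simp
      finally show ?thesis using A_pos[of i] by (simp add: field_simps)
    qed
  qed
  have F0: "F 0 = 0" and Fn: "F (int n) = 0" using f by (auto simp: F_def)
  \<comment> \<open>Summation by parts: the left side is the term of \<open>pt\<close> up to a
    telescoping difference of \<open>v (i - 1) * F i\<close>, which is written with
    \<open>i + 1 - 1\<close> to match the telescoping rule.\<close>
  have uF: "B (i - 1) * (f i)\<^sup>2 = v i * (F (i + 1) - F i) - (v (i + 1 - 1) * F (i + 1) - v (i - 1) * F i)"
    if "0 \<le> i" "i < int n" for i
  proof -
    have "u i * F i = (f i)\<^sup>2"
      using u_pos[of i] that f by (cases "i = 0") (auto simp: F_def)
    moreover have "v i * (F (i + 1) - F i) - (v (i + 1 - 1) * F (i + 1) - v (i - 1) * F i)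
        = - ((v i - v (i - 1)) * F i)"
      by (simp add: algebra_simps)
    ultimately show ?thesis unfolding dv by simp
  qed
  have "(\<Sum>i\<in>{0..<int n}. B (i - 1) * (f i)\<^sup>2) =
      (\<Sum>i\<in>{0..<int n}. v i * (F (i + 1) - F i))
      - (\<Sum>i\<in>{0..<0 + int n}. v (i + 1 - 1) * F (i + 1) - v (i - 1) * F i)"
    unfolding add_0 sum_subtractf[symmetric] by (intro sum.cong refl uF) auto
  also have "(\<Sum>i\<in>{0..<0 + int n}. v (i + 1 - 1) * F (i + 1) - v (i - 1) * F i) = 0"
    by (subst sum_window_telescope[of "\<lambda>i. v (i - 1) * F i"]) (simp add: F0 Fn)
  also have "(\<Sum>i\<in>{0..<int n}. v i * (F (i + 1) - F i)) \<le> (\<Sum>i\<in>{0..<int n}. (f (i + 1) - f i)\<^sup>2 / A i)"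
    by (intro sum_mono pt) auto
  finally show ?thesis by simp
qed

text \<open>Subtracting the extremal sequence \<open>r\<close> with \<open>r 0 = f 0\<close> reduces
  to sequences vanishing at both ends. The difference of the two sides is a quadratic form with
  \<open>r\<close> in its kernel, so the subtraction does not change its value.\<close>

lemma wirtinger:
  assumes f: "\<And>i. f (i + int n) = - f i"
  shows "(\<Sum>i\<in>{0..<int n}. B (i - 1) * (f i)\<^sup>2) \<le> (\<Sum>i\<in>{0..<int n}. (f (i + 1) - f i)\<^sup>2 / A i)"
proof -
  define r where "r i = - f 0 * det2 (V 0) (U i)" for i
  define z where "z i = f i - r i" for i
  define t where "t i = - f 0 * det2 (V 0) (V i)" for i
  have r_anti: "r (i + int n) = - r i" and t_anti: "t (i + int n) = - t i" for i
    by (simp_all add: r_def t_def sym V_sym det2_simps)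
  have dr: "r (i + 1) - r i = A i * t i" for i
    using arg_cong[OF edge[of i], of "det2 (V 0)"] by (simp add: r_def t_def det2_simps algebra_simps)
  have dt: "t i - t (i - 1) = - (B (i - 1) * r i)" for i
    using arg_cong[OF V_edge[of "i - 1"], of "\<lambda>w. - f 0 * det2 (V 0) w"]
    by (simp add: r_def t_def det2_simps algebra_simps)
  \<comment> \<open>As \<open>r\<close> solves the Euler-Lagrange equations \<open>dr\<close> and
    \<open>dt\<close>, the bilinear form telescopes; the end terms cancel because \<open>g\<close>
    and \<open>t\<close> are both antiperiodic.\<close>
  have cross: "(\<Sum>i\<in>{0..<int n}. (g (i + 1) - g i) * (r (i + 1) - r i) / A i - B (i - 1) * g i * r i) = 0"
    if g: "\<And>i. g (i + int n) = - g i" for g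
  proof -
    have "(g (i + 1) - g i) * (r (i + 1) - r i) / A i - B (i - 1) * g i * r i
        = g (i + 1) * t (i + 1 - 1) - g i * t (i - 1)" for i
    proof -
      have "(g (i + 1) - g i) * (r (i + 1) - r i) / A i = (g (i + 1) - g i) * t i"
        using A_pos[of i] by (simp add: dr)
      moreover have "B (i - 1) * g i * r i = - (t i - t (i - 1)) * g i"
        by (simp add: dt)
      ultimately show ?thesis by (simp add: algebra_simps)
    qed
    then show ?thesis
      using sum_window_telescope[of "\<lambda>i. g i * t (i - 1)" 0 n] g[of 0] t_anti[of "-1"] by simp
  qed
  have z_anti: "z (i + int n) = - z i" for i by (simp add: z_def f r_anti)
  have "z 0 = 0" by (simp add: z_def r_def det_VU)
  then have "(\<Sum>i\<in>{0..<int n}. B (i - 1) * (z i)\<^sup>2) \<le> (\<Sum>i\<in>{0..<int n}. (z (i + 1) - z i)\<^sup>2 / A i)"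
    using z_anti[of 0] by (intro wirtinger_vanishing) auto
  also have "(\<Sum>i\<in>{0..<int n}. (z (i + 1) - z i)\<^sup>2 / A i) - (\<Sum>i\<in>{0..<int n}. B (i - 1) * (z i)\<^sup>2)
      = (\<Sum>i\<in>{0..<int n}. (f (i + 1) - f i)\<^sup>2 / A i) - (\<Sum>i\<in>{0..<int n}. B (i - 1) * (f i)\<^sup>2)
        - 2 * (\<Sum>i\<in>{0..<int n}. (f (i + 1) - f i) * (r (i + 1) - r i) / A i - B (i - 1) * f i * r i)
        + (\<Sum>i\<in>{0..<int n}. (r (i + 1) - r i) * (r (i + 1) - r i) / A i - B (i - 1) * r i * r i)"
    unfolding sum_subtractf[symmetric] sum_distrib_left sum.distrib[symmetric]
  proof (intro sum.cong refl)
    fix i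
    show "(z (i + 1) - z i)\<^sup>2 / A i - B (i - 1) * (z i)\<^sup>2 =
      (f (i + 1) - f i)\<^sup>2 / A i - B (i - 1) * (f i)\<^sup>2
      - 2 * ((f (i + 1) - f i) * (r (i + 1) - r i) / A i - B (i - 1) * f i * r i)
      + ((r (i + 1) - r i) * (r (i + 1) - r i) / A i - B (i - 1) * r i * r i)"
      by (simp add: z_def power2_eq_square diff_divide_distrib add_divide_distrib algebra_simps)
  qed
  finally show ?thesis unfolding cross[of f, OF f] cross[of r, OF r_anti] by simp
qed

section \<open>Energy and moment under an involute\<close>

definition energy :: "(int \<Rightarrow> real^2) \<Rightarrow> real^2 \<Rightarrow> real" where
  "energy X x = (\<Sum>i\<in>{0..<int n}. A i * (supp U X x i)\<^sup>2)"

lemma energy_nonneg: "energy X x \<ge> 0"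
  unfolding energy_def using A_pos by (intro sum_nonneg) (simp add: less_imp_le)

text \<open>Abel summation: the summands differ by the telescoping difference of
  \<open>g (i - 1) *\<^sub>R V i\<close>, a product of two antiperiodic sequences and hence equal at
  both ends.\<close>

lemma moment_InvM:
  assumes X: "admissible n U X"
  shows "convex_sym.moment n V (InvM n U X) x = moment X x"
proof -
  interpret dual: convex_sym n V by (rule convex_sym_dual)
  define h where "h = supp U X x"
  define g where "g = supp V (InvM n U X) x"
  have g_anti: "g (i + int n) = - g i" for i
    unfolding g_def by (rule dual.supp_anti[OF admissible_InvM[OF X]])
  have step: "g i - g (i - 1) = - (A i * h i)" for i
    unfolding g_def h_def by (rule supp_InvM[OF X])
  have "(B i * g i) *\<^sub>R Vvec V i - (A i * h i) *\<^sub>R V i =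
      g (i + 1 - 1) *\<^sub>R V (i + 1) - g (i - 1) *\<^sub>R V i" for i
  proof -
    have "(B i * g i) *\<^sub>R Vvec V i = g i *\<^sub>R (V (i + 1) - V i)"
      by (simp add: dual.edge mult.commute)
    moreover have "(A i * h i) *\<^sub>R V i = - (g i - g (i - 1)) *\<^sub>R V i" by (simp add: step)
    ultimately show ?thesis unfolding scaleR_diff_left scaleR_diff_right scaleR_minus_left by simp
  qed
  then have "dual.moment (InvM n U X) x - moment X x = 0"
    using sum_window_telescope[of "\<lambda>i. g (i - 1) *\<^sub>R V i" 0 n] g_anti[of "-1"] V_sym[of 0]
    by (simp add: dual.moment_def moment_def g_def h_def sum_subtractf[symmetric])
  then show ?thesis by simp
qed

text \<open>This is \<open>wirtinger\<close> for the positions relative to the involute: by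
  \<open>supp_InvM\<close> their squared differences divided by \<open>A i\<close> are exactly the
  terms of the old energy. The shift in \<open>g\<close> turns backward into forward
  differences.\<close>

lemma energy_InvM_le:
  assumes X: "admissible n U X"
  shows "convex_sym.energy n V (InvM n U X) x \<le> energy X x"
proof -
  interpret dual: convex_sym n V by (rule convex_sym_dual)
  define g where "g i = supp V (InvM n U X) x (i - 1)" for i
  have g_anti: "g (i + int n) = - g i" for i
    using dual.supp_anti[OF admissible_InvM[OF X], of x "i - 1"] by (simp add: g_def diff_add_eq)
  have step: "g (i + 1) - g i = - (A i * supp U X x i)" for i
    using supp_InvM[OF X, of x i] by (simp add: g_def)
  have "B (i + int n - 1) * (g (i + int n))\<^sup>2 = B (i - 1) * (g i)\<^sup>2" for i
    using V_sym[of "i - 1"] V_sym[of i] g_anti[of i] by (simp add: diff_add_eq det2_simps)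
  then have "dual.energy (InvM n U X) x = (\<Sum>i\<in>{0..<int n}. B (i - 1) * (g i)\<^sup>2)"
    using sum_period_shift[of "\<lambda>i. B (i - 1) * (g i)\<^sup>2" n 1] by (simp add: dual.energy_def g_def)
  also have "\<dots> \<le> (\<Sum>i\<in>{0..<int n}. (g (i + 1) - g i)\<^sup>2 / A i)"
    by (rule wirtinger[of g, OF g_anti])
  also have "\<dots> = energy X x"
    unfolding energy_def using A_pos
    by (intro sum.cong refl) (simp add: step power2_eq_square less_imp_neq[symmetric])
  finally show ?thesis .
qed

text \<open>Expanding the square of the length as \<open>(h i + k (i - 1))\<^sup>2\<close> gives the
  first and third energies; summation by parts turns the mixed term into the middle one.\<close>

lemma energy_second_difference:
  assumes X: "admissible n U X"
  shows "energy X x - 2 * convex_sym.energy n V (InvM n U X) x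
      + convex_sym.energy n (Vvec V) (InvM n V (InvM n U X)) x
    = (\<Sum>i\<in>{0..<int n}. A i * (convex_sym.offset n V (InvM n U X) i)\<^sup>2)"
proof -
  interpret dual: convex_sym n V by (rule convex_sym_dual)
  interpret dual2: convex_sym n "Vvec V" by (rule dual.convex_sym_dual)
  define Y where "Y = InvM n U X"
  define Z where "Z = InvM n V Y"
  define h where "h = supp U X x"
  define g where "g = supp V Y x"
  define k where "k = supp (Vvec V) Z x"
  have Y: "admissible n V Y" unfolding Y_def by (rule admissible_InvM[OF X])
  have Z: "admissible n (Vvec V) Z" unfolding Z_def by (rule dual.admissible_InvM[OF Y])
  have g_anti: "g (i + int n) = - g i" for i unfolding g_def by (rule dual.supp_anti[OF Y])
  have k_anti: "k (i + int n) = - k i" for i unfolding k_def by (rule dual2.supp_anti[OF Z])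
  have g_step: "g i - g (i - 1) = - (A i * h i)" for i
    unfolding g_def h_def Y_def by (rule supp_InvM[OF X])
  have k_step: "k i - k (i - 1) = - (B i * g i)" for i
    unfolding k_def g_def Z_def by (rule dual.supp_InvM[OF Y])
  \<comment> \<open>\<open>h i\<close> and \<open>k (i - 1)\<close> refer to parallel lines with
    opposite orientation. Their sum is therefore independent of \<open>x\<close> and measures the
    gap between these lines.\<close>
  have b: "dual.offset Y i = - (h i + k (i - 1))" for i
  proof -
    have "Z (i - 1) = Y i - dual.offset Y i *\<^sub>R U i"
      using dual.InvM_offset'[OF Y, of "i - 1"] by (simp add: Z_def Vvec_V)
    moreover have "Y i = X i + offset X i *\<^sub>R V i" unfolding Y_def by (rule InvM_offset[OF X])
    ultimately show ?thesis
      by (simp add: h_def k_def supp_def dual.Vvec_V det2_simps det_UV)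
  qed
  have "(\<Sum>i\<in>{0..<int n}. A i * h i * k (i - 1)) + dual.energy Y x =
      (\<Sum>i\<in>{0..<int n}. g (i - 1) * k (i - 1) - g i * k i)"
    unfolding dual.energy_def sum.distrib[symmetric]
  proof (intro sum.cong refl)
    fix i
    have "A i * h i * k (i - 1) = - (g i - g (i - 1)) * k (i - 1)" by (simp add: g_step)
    moreover have "B i * (supp V Y x i)\<^sup>2 = - (k i - k (i - 1)) * g i"
      by (simp add: k_step g_def power2_eq_square)
    ultimately show "A i * h i * k (i - 1) + B i * (supp V Y x i)\<^sup>2 = g (i - 1) * k (i - 1) - g i * k i"
      by (simp add: algebra_simps)
  qed
  also have "\<dots> = 0"
    using sum_window_telescope[of "\<lambda>i. g (i - 1) * k (i - 1)" 0 n] g_anti[of "-1"] k_anti[of "-1"]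
    by (simp add: sum_subtractf)
  finally have 1: "(\<Sum>i\<in>{0..<int n}. A i * h i * k (i - 1)) = - dual.energy Y x" by simp
  have per: "A (i + int n) * (k (i + int n - 1))\<^sup>2 = A i * (k (i - 1))\<^sup>2" for i
    using sym[of i] sym[of "i + 1"] k_anti[of "i - 1"] by (simp add: algebra_simps det2_simps)
  have 2: "dual2.energy Z x = (\<Sum>i\<in>{0..<int n}. A i * (k (i - 1))\<^sup>2)"
    using sum_period_shift[of "\<lambda>i. A i * (k (i - 1))\<^sup>2" n 1, OF per]
    by (simp add: dual2.energy_def k_def Vvec_V det2_simps)
  have "(\<Sum>i\<in>{0..<int n}. A i * (dual.offset Y i)\<^sup>2) =
      (\<Sum>i\<in>{0..<int n}. A i * (h i)\<^sup>2 + (2 * (A i * h i * k (i - 1)) + A i * (k (i - 1))\<^sup>2))"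
    by (intro sum.cong refl) (simp add: b power2_eq_square algebra_simps)
  also have "\<dots> = energy X x + (2 * (- dual.energy Y x) + dual2.energy Z x)"
    unfolding sum.distrib sum_distrib_left[symmetric] 1 2 by (simp add: energy_def h_def)
  finally show ?thesis by (simp add: Y_def Z_def)
qed

text \<open>The linear part does not involve \<open>X\<close>. With a vertex of \<open>X\<close> as
  \<open>p\<close>, the remainder is small once the polygon is small.\<close>

lemma moment_affine: "moment X x = moment (\<lambda>_. 0) (x - p) + (\<Sum>i\<in>{0..<int n}. (A i * det2 (p - X i) (V i)) *\<^sub>R V i)"
  unfolding moment_def sum.distrib[symmetric]
proof (intro sum.cong refl)
  fix i
  have "supp U X x i = supp U (\<lambda>_. 0) (x - p) i + det2 (p - X i) (V i)"
    by (simp add: supp_def det2_simps)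
  then show "(A i * supp U X x i) *\<^sub>R V i =
      (A i * supp U (\<lambda>_. 0) (x - p) i) *\<^sub>R V i + (A i * det2 (p - X i) (V i)) *\<^sub>R V i"
    by (simp add: distrib_left scaleR_add_left)
qed

lemma linear_moment: "linear (moment (\<lambda>_. 0))"
  by (intro linearI)
     (simp_all add: moment_def supp_def det2_simps distrib_left scaleR_add_left sum.distrib scaleR_sum_right
        mult.left_commute)

text \<open>Pairing the value at \<open>y\<close> with \<open>y\<close> gives a positively weighted
  sum of squares, so a kernel vector is parallel to both \<open>V 0\<close> and
  \<open>V 1\<close>.\<close>

lemma inj_moment: "inj (moment (\<lambda>_. 0))"
proof (rule linear_injective_0[OF linear_moment, THEN iffD2], intro allI impI)
  fix y assume "moment (\<lambda>_. 0) y = 0"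
  then have "det2 y (moment (\<lambda>_. 0) y) = 0" by (simp add: det2_simps)
  also have "det2 y (moment (\<lambda>_. 0) y) = (\<Sum>i\<in>{0..<int n}. A i * (det2 y (V i))\<^sup>2)"
    by (simp add: moment_def supp_def det2_sum_right det2_simps power2_eq_square mult.assoc)
  finally have z: "\<forall>i\<in>{0..<int n}. A i * (det2 y (V i))\<^sup>2 = 0"
    using A_pos by (subst (asm) sum_nonneg_eq_0_iff) (auto simp: less_imp_le)
  have "det2 y (V i) = 0" if "0 \<le> i" "i < int n" for i
    using z that A_pos[of i] by (metis atLeastLessThan_iff less_irrefl mult_eq_0_iff power_eq_0_iff)
  from this[of 0] this[of 1] show "y = 0"
    using n2 B_pos[of 0] det2_swap[of "V 0" y]
    by (intro det2_eqI[of "V 0" "V 1"]) (simp_all add: det2_simps)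
qed

lemma moment_zero_exists: "\<exists>x. moment X x = 0"
proof -
  have "surj (moment (\<lambda>_. 0))"
    by (rule linear_inj_imp_surj[OF linear_moment inj_moment])
  then obtain y where y: "- (\<Sum>i\<in>{0..<int n}. (A i * det2 (0 - X i) (V i)) *\<^sub>R V i) = moment (\<lambda>_. 0) y"
    by (rule surjE)
  have "moment X y = 0"
    by (subst moment_affine[of X y 0]) (simp only: diff_zero y[symmetric] ab_left_minus)
  then show ?thesis by blast
qed

end

section \<open>Iterated involutes\<close>

lemma finite_range_periodic:
  fixes f :: "int \<Rightarrow> 'a"
  assumes "\<And>i. f (i + p) = f i" "p > 0"
  shows "finite (range f)"
proof (rule finite_subset)
  show "range f \<subseteq> f ` {0..<p}"
  proof safe
    fix i show "f i \<in> f ` {0..<p}"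
      using periodic_mod[of f p i, OF assms(1)] assms(2) by (intro image_eqI[of _ _ "i mod p"]) auto
  qed
qed simp

text \<open>Both sequences of polygons are merged into one: with the reference polygon dualised at
  each step, operation (b) becomes another instance of (a).\<close>

fun involutes :: "nat \<Rightarrow> (int \<Rightarrow> real^2) \<Rightarrow> (int \<Rightarrow> real^2) \<Rightarrow> nat \<Rightarrow> (int \<Rightarrow> real^2)" where
  "involutes n U X 0 = X"
| "involutes n U X (Suc k) = InvM n ((Vvec ^^ k) U) (involutes n U X k)"

context convex_sym
begin

abbreviation W where "W k \<equiv> (Vvec ^^ k) U"

lemma convex_sym_W: "convex_sym n (W k)"
  by (induction k) (auto intro: convex_sym.convex_sym_dual convex_sym_axioms)

lemma W_Suc_Suc: "W (Suc (Suc k)) i = - W k (i + 1)"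
  using convex_sym.Vvec_V[OF convex_sym_W[of k]] by simp

text \<open>By \<open>W_Suc_Suc\<close> the iterates repeat up to sign and index shift, so bounds
  for \<open>W 0\<close> and \<open>W 1\<close>, each with finitely many values, hold for all
  \<open>k\<close>. The next lemma uses the same principle.\<close>

lemma norm_W_bounded: "\<exists>C. \<forall>k i. norm (W k i) \<le> C"
proof -
  have b: "\<exists>C. \<forall>i. norm (W k i) \<le> C" for k
  proof -
    have "norm (W k (i + int n)) = norm (W k i)" for i
      using convex_sym.sym[OF convex_sym_W[of k]] by simp
    then have "finite (range (\<lambda>i. norm (W k i)))" using n2 by (intro finite_range_periodic) auto
    then show ?thesis by (meson Max_ge rangeI)
  qed
  obtain C0 C1 where C: "\<And>i. norm (W 0 i) \<le> C0" "\<And>i. norm (W 1 i) \<le> C1" using b by metis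
  have "(\<forall>i. norm (W k i) \<le> max C0 C1) \<and> (\<forall>i. norm (W (Suc k) i) \<le> max C0 C1)" for k
  proof (induction k)
    case 0
    then show ?case using C by (simp add: le_max_iff_disj)
  next
    case (Suc k)
    then show ?case unfolding W_Suc_Suc by simp
  qed
  then show ?thesis by blast
qed

lemma det_W_bounded_below: "\<exists>\<kappa>>0. \<forall>k i. \<kappa> \<le> det2 (W k i) (W k (i + 1))"
proof -
  have b: "\<exists>\<kappa>>0. \<forall>i. \<kappa> \<le> det2 (W k i) (W k (i + 1))" for k
  proof -
    interpret k: convex_sym n "W k" by (rule convex_sym_W)
    have "k.A (i + int n) = k.A i" for i
      using k.sym[of i] k.sym[of "i + 1"] by (simp add: det2_simps algebra_simps)
    then have fin: "finite (range k.A)" using n2 by (intro finite_range_periodic) auto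
    show ?thesis
    proof (intro exI conjI allI)
      show "Min (range k.A) > 0" using fin k.A_pos by simp
      show "Min (range k.A) \<le> k.A i" for i using fin by simp
    qed
  qed
  obtain \<kappa>0 \<kappa>1 where \<kappa>: "\<kappa>0 > 0" "\<kappa>1 > 0"
    "\<And>i. \<kappa>0 \<le> det2 (W 0 i) (W 0 (i + 1))" "\<And>i. \<kappa>1 \<le> det2 (W 1 i) (W 1 (i + 1))"
    using b by metis
  have "(\<forall>i. min \<kappa>0 \<kappa>1 \<le> det2 (W k i) (W k (i + 1)))
      \<and> (\<forall>i. min \<kappa>0 \<kappa>1 \<le> det2 (W (Suc k) i) (W (Suc k) (i + 1)))" for k
  proof (induction k)
    case 0
    then show ?case using \<kappa> by (simp add: min_le_iff_disj)
  next
    case (Suc k)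
    have "det2 (W (Suc (Suc k)) i) (W (Suc (Suc k)) (i + 1)) = det2 (W k (i + 1)) (W k (i + 1 + 1))" for i
      unfolding W_Suc_Suc by (simp only: det2_simps minus_minus)
    then show ?case using Suc by metis
  qed
  then show ?thesis using \<kappa> by (intro exI[of _ "min \<kappa>0 \<kappa>1"]) auto
qed

lemma admissible_involutes:
  assumes "admissible n U X"
  shows "admissible n (W k) (involutes n U X k)"
  by (induction k) (auto intro: assms convex_sym.admissible_InvM[OF convex_sym_W])

lemma moment_involutes:
  assumes "admissible n U X"
  shows "convex_sym.moment n (W k) (involutes n U X k) x = moment X x"
proof (induction k)
  case (Suc k)
  then show ?case
    using convex_sym.moment_InvM[OF convex_sym_W[of k] admissible_involutes[OF assms, of k]] by simp
qed simp

text \<open>The polygon constantly 0 is its own involute, so conservation of the moment applied to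
  it shows that the linear part is the same at every step.\<close>

lemma moment_W: "convex_sym.moment n (W k) (\<lambda>_. 0) x = moment (\<lambda>_. 0) x"
proof -
  have ad: "admissible n U (\<lambda>_. 0)"
    by (auto simp: admissible_def intro: exI[of _ 0])
  have "involutes n U (\<lambda>_. 0) k = (\<lambda>_. 0)"
    by (induction k) (simp_all add: InvM_def coef_def)
  then show ?thesis using moment_involutes[OF ad, of k x] by simp
qed

lemma one_sign_involutes:
  assumes X: "admissible n U X" and "one_sign n (supp U X x)"
  shows "one_sign n (supp (W k) (involutes n U X k) x)"
proof (induction k)
  case (Suc k)
  interpret k: convex_sym n "W k" by (rule convex_sym_W)
  interpret Suc: convex_sym n "W (Suc k)" by (rule convex_sym_W)
  show ?case
  proof (rule one_sign_step[where \<alpha> = k.A, OF _ _ _ _ Suc.IH])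
    show "supp (W (Suc k)) (involutes n U X (Suc k)) x i - supp (W (Suc k)) (involutes n U X (Suc k)) x (i - 1)
        = - (k.A i * supp (W k) (involutes n U X k) x i)" for i
      using k.supp_InvM[OF admissible_involutes[OF X]] by simp
    show "supp (W (Suc k)) (involutes n U X (Suc k)) x (i + int n)
        = - supp (W (Suc k)) (involutes n U X (Suc k)) x i" for i
      by (rule Suc.supp_anti[OF admissible_involutes[OF X]])
  qed (use n2 k.A_pos in \<open>auto simp: less_imp_le\<close>)
qed (use assms in simp)

section \<open>Convergence of the involutes\<close>

lemma offset_tendsto_0:
  assumes X: "admissible n U X"
  shows "(\<lambda>k. convex_sym.offset n (W k) (involutes n U X k) i) \<longlonglongrightarrow> 0"
proof -
  \<comment> \<open>The origin is an arbitrary choice of point: the offsets do not depend on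
    it.\<close>
  define \<sigma> where "\<sigma> k = convex_sym.energy n (W k) (involutes n U X k) 0" for k
  define off where "off k = convex_sym.offset n (W k) (involutes n U X k)" for k
  have "decseq \<sigma>"
    using convex_sym.energy_InvM_le[OF convex_sym_W admissible_involutes[OF X]]
    by (simp add: decseq_Suc_iff \<sigma>_def)
  moreover have "\<sigma> k \<ge> 0" for k
    unfolding \<sigma>_def by (rule convex_sym.energy_nonneg[OF convex_sym_W])
  ultimately obtain L where L: "\<sigma> \<longlonglongrightarrow> L" by (metis decseq_convergent)
  have "(\<lambda>k. \<sigma> k - 2 * \<sigma> (Suc k) + \<sigma> (Suc (Suc k))) \<longlonglongrightarrow> L - 2 * L + L"
    by (intro tendsto_intros L LIMSEQ_Suc)
  then have lim: "(\<lambda>k. \<sigma> k - 2 * \<sigma> (Suc k) + \<sigma> (Suc (Suc k))) \<longlonglongrightarrow> 0" by simp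
  obtain \<kappa> where \<kappa>: "\<kappa> > 0" "\<And>k i. \<kappa> \<le> det2 (W k i) (W k (i + 1))"
    using det_W_bounded_below by blast
  \<comment> \<open>The second difference is a sum of weighted squares whose weights are at least
    \<open>\<kappa>\<close> for all \<open>k\<close>, so it bounds every single square.\<close>
  have sq: "(off (Suc k) i)\<^sup>2 \<le> (\<sigma> k - 2 * \<sigma> (Suc k) + \<sigma> (Suc (Suc k))) / \<kappa>" if "i \<in> {0..<int n}" for k i
  proof -
    interpret k: convex_sym n "W k" by (rule convex_sym_W)
    have "\<kappa> * (off (Suc k) i)\<^sup>2 \<le> k.A i * (off (Suc k) i)\<^sup>2"
      using \<kappa>(2) by (intro mult_right_mono) auto
    also have "\<dots> \<le> (\<Sum>i\<in>{0..<int n}. k.A i * (off (Suc k) i)\<^sup>2)"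
      using that k.A_pos by (intro member_le_sum) (auto simp: less_imp_le)
    also have "\<dots> = \<sigma> k - 2 * \<sigma> (Suc k) + \<sigma> (Suc (Suc k))"
      using k.energy_second_difference[OF admissible_involutes[OF X], of 0]
      by (simp add: off_def \<sigma>_def)
    finally show ?thesis using \<kappa>(1) by (simp add: pos_le_divide_eq mult.commute)
  qed
  have "(\<lambda>k. (off (Suc k) j)\<^sup>2) \<longlonglongrightarrow> 0" if "j \<in> {0..<int n}" for j
  proof (rule tendsto_sandwich[OF _ _ tendsto_const])
    show "(\<lambda>k. (\<sigma> k - 2 * \<sigma> (Suc k) + \<sigma> (Suc (Suc k))) / \<kappa>) \<longlonglongrightarrow> 0"
      using tendsto_divide[OF lim tendsto_const[of \<kappa>]] \<kappa>(1) by simp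
  qed (use sq[OF that] in auto)
  then have "(\<lambda>k. (off (Suc k) (i mod int n))\<^sup>2) \<longlonglongrightarrow> 0" using n2 by simp
  moreover have "(off k (i mod int n))\<^sup>2 = (off k i)\<^sup>2" for k
    using convex_sym.offset_anti[OF convex_sym_W admissible_involutes[OF X]]
    by (intro periodic_mod[of "\<lambda>i. (off k i)\<^sup>2"]) (simp add: off_def)
  ultimately have "(\<lambda>k. sqrt ((off (Suc k) i)\<^sup>2)) \<longlonglongrightarrow> sqrt 0"
    by (intro tendsto_real_sqrt) simp
  then have "(\<lambda>k. off (Suc k) i) \<longlonglongrightarrow> 0"
    by (simp add: tendsto_rabs_zero_iff)
  then show ?thesis unfolding off_def by (rule LIMSEQ_imp_Suc)
qed

lemma involutes_tendsto:
  assumes X: "admissible n U X" and x: "moment X x = 0"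
  shows "(\<lambda>k. involutes n U X k i) \<longlonglongrightarrow> x"
proof -
  define Z where "Z = involutes n U X"
  define off where "off k = convex_sym.offset n (W k) (Z k)" for k
  have off: "(\<lambda>k. off k i) \<longlonglongrightarrow> 0" for i
    unfolding off_def Z_def by (rule offset_tendsto_0[OF X])
  obtain C where C: "\<And>k i. norm (W k i) \<le> C" using norm_W_bounded by blast
  then have "C \<ge> 0" using norm_ge_zero order_trans by blast
  have edge_lim: "(\<lambda>k. Z k (i + 1) - Z k i) \<longlonglongrightarrow> 0" for i
  proof (rule Lim_null_comparison)
    have "norm (Z k (i + 1) - Z k i) \<le> \<bar>off k i - off k (i + 1)\<bar> * C" for k
      using convex_sym.edge_offset[OF convex_sym_W admissible_involutes[OF X], of k i] C[of "Suc k" i]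
      by (simp add: Z_def off_def mult_left_mono)
    then show "\<forall>\<^sub>F k in sequentially. norm (Z k (i + 1) - Z k i) \<le> \<bar>off k i - off k (i + 1)\<bar> * C" by simp
    have "(\<lambda>k. \<bar>off k i - off k (i + 1)\<bar> * C) \<longlonglongrightarrow> \<bar>0 - 0\<bar> * C"
      by (intro tendsto_intros off)
    then show "(\<lambda>k. \<bar>off k i - off k (i + 1)\<bar> * C) \<longlonglongrightarrow> 0" by simp
  qed
  have diff_lim: "(\<lambda>k. Z k i - Z k 0) \<longlonglongrightarrow> 0" for i
  proof (induction i rule: int_induct[where k = 0])
    case (step1 i)
    from tendsto_add[OF step1(2) edge_lim[of i]] show ?case by simp
  next
    case (step2 i)
    from tendsto_diff[OF step2(2) edge_lim[of "i - 1"]] show ?case by simp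
  qed simp
  define R where "R k = (\<Sum>i\<in>{0..<int n}. (det2 (W k i) (W k (i + 1)) * det2 (Z k 0 - Z k i) (W (Suc k) i)) *\<^sub>R W (Suc k) i)" for k
  \<comment> \<open>Conservation of the moment, expanded about the vertex \<open>Z k 0\<close>. As
    the polygon shrinks, \<open>R k\<close> tends to 0, and injectivity of the linear part carries
    this over to \<open>x - Z k 0\<close>.\<close>
  have mom: "moment (\<lambda>_. 0) (x - Z k 0) = - R k" for k
    using convex_sym.moment_affine[OF convex_sym_W, of k "Z k" x "Z k 0"]
      moment_involutes[OF X, of k x] moment_W[of k "x - Z k 0"]
    by (simp add: x R_def Z_def eq_neg_iff_add_eq_0)
  obtain b where b: "b > 0" "\<And>y. b * norm y \<le> norm (moment (\<lambda>_. 0) y)"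
    using linear_inj_bounded_below_pos[OF linear_moment inj_moment] by blast
  define S where "S k = (\<Sum>i\<in>{0..<int n}. (C * C) * (norm (Z k i - Z k 0) * C) * C)" for k
  have "(\<lambda>k. x - Z k 0) \<longlonglongrightarrow> 0"
  proof (rule Lim_null_comparison)
    have "norm (R k) \<le> S k" for k
      unfolding R_def S_def
    proof (rule sum_norm_le)
      fix i
      have "\<bar>det2 (W k i) (W k (i + 1))\<bar> \<le> C * C"
        using C \<open>C \<ge> 0\<close> by (intro order_trans[OF abs_det2_le mult_mono]) auto
      moreover have "\<bar>det2 (Z k 0 - Z k i) (W (Suc k) i)\<bar> \<le> norm (Z k i - Z k 0) * C"
        unfolding norm_minus_commute[of "Z k i" "Z k 0"]
        by (intro order_trans[OF abs_det2_le] mult_left_mono C norm_ge_zero)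
      ultimately show "norm ((det2 (W k i) (W k (i + 1)) * det2 (Z k 0 - Z k i) (W (Suc k) i)) *\<^sub>R W (Suc k) i)
          \<le> (C * C) * (norm (Z k i - Z k 0) * C) * C"
        unfolding norm_scaleR abs_mult using C[of "Suc k" i] \<open>C \<ge> 0\<close>
        by (intro mult_mono) auto
    qed
    then have "b * norm (x - Z k 0) \<le> S k" for k
      using b(2)[of "x - Z k 0"] order_trans unfolding mom norm_minus_cancel S_def by blast
    then show "\<forall>\<^sub>F k in sequentially. norm (x - Z k 0) \<le> S k / b"
      using b(1) by (simp add: pos_le_divide_eq mult.commute)
    have "(\<lambda>k. S k / b) \<longlonglongrightarrow> (\<Sum>i\<in>{0..<int n}. (C * C) * (norm (0 :: real^2) * C) * C) / b"
      unfolding S_def using b(1) by (intro tendsto_intros diff_lim) auto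
    then show "(\<lambda>k. S k / b) \<longlonglongrightarrow> 0" by simp
  qed
  from tendsto_diff[OF diff_lim[of i] this] have "(\<lambda>k. Z k i - x) \<longlonglongrightarrow> 0" by simp
  then show ?thesis unfolding Z_def by (simp add: LIM_zero_iff)
qed

text \<open>Uniformity in \<open>i\<close> is needed because the index of a fixed vertex of
  \<open>M(k)\<close> or \<open>N(k + 1)\<close> within \<open>involutes\<close> moves with
  \<open>k\<close>.\<close>

lemma involutes_tendsto_uniformly:
  assumes X: "admissible n U X" and x: "moment X x = 0" and e: "e > 0"
  shows "\<exists>K. \<forall>k\<ge>K. \<forall>i. dist (involutes n U X k i) x < e"
proof -
  have "\<forall>\<^sub>F k in sequentially. \<forall>i\<in>{0..<int n}. dist (involutes n U X k i) x < e"
    using involutes_tendsto[OF X x] e by (intro eventually_ball_finite) (auto dest: tendstoD)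
  then obtain K where K: "\<And>k i. k \<ge> K \<Longrightarrow> i \<in> {0..<int n} \<Longrightarrow> dist (involutes n U X k i) x < e"
    unfolding eventually_sequentially by blast
  have "dist (involutes n U X k i) x < e" if "k \<ge> K" for k i
  proof -
    have "involutes n U X k (i mod int n) = involutes n U X k i"
      using admissible_involutes[OF X, of k] by (intro periodic_mod) (simp add: admissible_def)
    then show ?thesis using K[OF that, of "i mod int n"] n2 by simp
  qed
  then show ?thesis by blast
qed

end

section \<open>Index shifts, sign changes and small curves\<close>

lemma InvM_shift: "InvM n (\<lambda>i. U (i + d)) (\<lambda>i. X (i + d)) = (\<lambda>i. InvM n U X (i + d))"
proof
  fix i
  have "(\<Sum>j\<in>{i + d..i + d + int n - 1}. f j) = (\<Sum>j\<in>{i..i + int n - 1}. f (j + d))" for f :: "int \<Rightarrow> real"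
    by (rule sum.reindex_bij_witness[of _ "\<lambda>j. j + d" "\<lambda>j. j - d"]) auto
  moreover have "j + 1 + d = j + d + 1" for j by simp
  ultimately show "InvM n (\<lambda>i. U (i + d)) (\<lambda>i. X (i + d)) i = InvM n U X (i + d)"
    by (simp only: InvM_def Let_def Vvec_def)
qed

lemma Vvec_shift: "Vvec (\<lambda>i. U (i + d)) = (\<lambda>i. Vvec U (i + d))"
  by (simp add: Vvec_def fun_eq_iff add.commute add.left_commute)

lemma Vvec_uminus: "Vvec (\<lambda>i. - U i) = (\<lambda>i. - Vvec U i)"
  unfolding Vvec_def fun_eq_iff by (simp add: det2_simps flip: scaleR_minus_right)

text \<open>The determinants stay the same, while the coefficients and \<open>Vvec\<close> both
  change sign, which cancels in the product.\<close>

lemma InvM_uminus: "InvM n (\<lambda>i. - U i) X = InvM n U X"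
proof -
  have "coef w (- d) = - coef w d" for w d by (simp add: coef_def)
  moreover have "- U (i + 1) - - U i = - (U (i + 1) - U i)" for i by simp
  ultimately show ?thesis
    by (simp only: InvM_def Let_def Vvec_uminus det2_simps minus_minus mult_minus_left sum_negf
        mult_minus_right scaleR_minus_left scaleR_minus_right)
qed

lemma polycurve_eq_Union:
  assumes "\<And>i. X (i + int m) = X i" "m > 0"
  shows "polycurve m X = (\<Union>i. closed_segment (X i) (X (i + 1)))"
  using segment_subset_polycurve[of X m, OF assms] by (auto simp: polycurve_def)

lemma polycurve_shift:
  assumes "\<And>i. X (i + int m) = X i" "m > 0"
  shows "polycurve m (\<lambda>i. X (i + d)) = polycurve m X"
proof -
  have per: "X (i + int m + d) = X (i + d)" for i
    using assms(1)[of "i + d"] by (simp add: algebra_simps)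
  have "(\<Union>i. closed_segment (X (i + d)) (X (i + 1 + d))) = (\<Union>i. closed_segment (X i) (X (i + 1)))"
  proof safe
    fix y i assume "y \<in> closed_segment (X (i + d)) (X (i + 1 + d))"
    then show "y \<in> (\<Union>i. closed_segment (X i) (X (i + 1)))"
      by (intro UN_I[of "i + d"]) (simp_all add: algebra_simps)
  next
    fix y i assume "y \<in> closed_segment (X i) (X (i + 1))"
    then show "y \<in> (\<Union>i. closed_segment (X (i + d)) (X (i + 1 + d)))"
      by (intro UN_I[of "i - d"]) (simp_all add: algebra_simps)
  qed
  then show ?thesis
    using polycurve_eq_Union[of X m, OF assms] polycurve_eq_Union[of "\<lambda>i. X (i + d)" m, OF per assms(2)]
    by simp
qed

text \<open>The curve stays inside the convex ball, and the complement of a ball in the plane is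
  path connected, so \<open>x\<close> and \<open>p\<close> can be joined outside it.\<close>

lemma not_in_region:
  assumes verts: "\<And>i. dist (X i) q < e" and x: "e \<le> dist x q" and p: "p \<in> Pc" "e \<le> dist p q"
  shows "x \<notin> region_rel Pc (polycurve m X)"
proof -
  have "closed_segment (X i) (X (i + 1)) \<subseteq> ball q e" for i
    using verts by (intro closed_segment_subset convex_ball) (simp_all add: dist_commute)
  then have sub: "polycurve m X \<subseteq> ball q e" by (auto simp: polycurve_def)
  have "path_connected (- ball q e)"
    by (rule path_connected_complement_bounded_convex) auto
  then obtain g where g: "path g" "path_image g \<subseteq> - ball q e" "pathstart g = x" "pathfinish g = p"
    using x p(2) unfolding path_connected_def by (metis ComplI dist_commute mem_ball not_le)
  then have "x \<in> exterior_rel Pc (polycurve m X)"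
    using sub p(1) unfolding exterior_rel_def by blast
  then show ?thesis by (simp add: region_rel_def)
qed

section \<open>Identification of M(k) and N(k) with the iterated involutes\<close>

context convex_sym
begin

lemma offset_eq: "offset X i = (1/2) * (\<Sum>j\<in>{i..i + int n - 1}. coef (X (j+1) - X j) (U (j+1) - U j) * A j)"
  by (simp add: offset_def InvM_def Let_def det2_simps det_UV)

text \<open>\<open>InvM\<close> measures from \<open>Y i\<close> and \<open>InvN\<close> at
  \<open>i + 1\<close> from \<open>Y (i + 1)\<close>; by \<open>InvM_offset'\<close> both ends give
  the same point. The sign in \<open>Vvec V i = - U (i + 1)\<close> accounts for the minus sign of
  \<open>t\<close>.\<close>

lemma InvN_eq_InvM:
  assumes Y: "admissible n V Y"
  shows "InvN n U Y (i + 1) = InvM n V Y i"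
proof -
  interpret dual: convex_sym n V by (rule convex_sym_dual)
  have "(\<Sum>j\<in>{i + 1 + 1..i + 1 + int n}. f j) = (\<Sum>j\<in>{i + 1..i + 1 + int n - 1}. f (j + 1))" for f :: "int \<Rightarrow> real"
    by (rule sum.reindex_bij_witness[of _ "\<lambda>j. j + 1" "\<lambda>j. j - 1"]) auto
  moreover have "InvM n V Y i = Y (i + 1) - dual.offset Y (i + 1) *\<^sub>R U (i + 1)"
    using dual.InvM_offset'[OF Y, of i] by (simp add: Vvec_V)
  ultimately show ?thesis
    by (simp add: InvN_def Let_def dual.offset_eq)
qed

lemma admissible_Mseq:
  assumes "admissible n U (Mseq n U P 0)"
  shows "admissible n U (Mseq n U P k)"
proof (induction k)
  case (Suc k)
  interpret dual: convex_sym n V by (rule convex_sym_dual)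
  define Y where "Y = InvM n U (Mseq n U P k)"
  have Y: "admissible n V Y" unfolding Y_def by (rule admissible_InvM[OF Suc])
  define Z where "Z = InvM n V Y"
  have Z: "admissible n (Vvec V) Z" unfolding Z_def by (rule dual.admissible_InvM[OF Y])
  have M: "Mseq n U P (Suc k) i = Z (i - 1)" for i
    using InvN_eq_InvM[OF Y, of "i - 1"] by (simp add: Y_def Z_def)
  show ?case
    unfolding admissible_def M
  proof (intro conjI allI)
    show "Z (i + int n - 1) = Z (i - 1)" for i
      using Z unfolding admissible_def by (metis diff_add_eq)
    fix i
    obtain a where "Z (i - 1 + 1) - Z (i - 1) = a *\<^sub>R (Vvec V (i - 1 + 1) - Vvec V (i - 1))"
      using Z unfolding admissible_def by blast
    then have "Z (i + 1 - 1) - Z (i - 1) = (- a) *\<^sub>R (U (i + 1) - U i)"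
      by (simp add: Vvec_V algebra_simps)
    then show "\<exists>a. Z (i + 1 - 1) - Z (i - 1) = a *\<^sub>R (U (i + 1) - U i)" by blast
  qed
qed (rule assms)

text \<open>The sign alternates with \<open>k\<close>; a disjunction suffices because
  \<open>InvM_uminus\<close> gives the same involute for both signs.\<close>

lemma W_even: "W (2 * k) = (\<lambda>i. U (i + int k)) \<or> W (2 * k) = (\<lambda>i. - U (i + int k))"
proof (induction k)
  case (Suc k)
  have "W (2 * Suc k) = (\<lambda>i. - W (2 * k) (i + 1))"
    using W_Suc_Suc[of "2 * k"] by (auto simp: fun_eq_iff)
  then show ?case using Suc by (auto simp: add.assoc)
qed simp

lemma InvM_W_even: "InvM n (W (2 * k)) (\<lambda>i. X (i + int k)) = (\<lambda>i. InvM n U X (i + int k))"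
  using W_even[of k] by (elim disjE) (simp_all only: InvM_uminus InvM_shift)

lemma InvM_W_odd: "InvM n (W (Suc (2 * k))) (\<lambda>i. X (i + int k)) = (\<lambda>i. InvM n V X (i + int k))"
  using W_even[of k]
  by (elim disjE) (simp_all only: funpow.simps o_apply Vvec_uminus Vvec_shift InvM_uminus InvM_shift)

text \<open>Two steps of \<open>involutes\<close> shift the index by one, because \<open>Vvec V i = - U (i + 1)\<close>.\<close>
lemma
  assumes "admissible n U (Mseq n U P 0)"
  shows involutes_even: "involutes n U (Mseq n U P 0) (2 * k) = (\<lambda>i. Mseq n U P k (i + int k))"
    and involutes_odd: "involutes n U (Mseq n U P 0) (Suc (2 * k)) = (\<lambda>i. Nseq n U P (Suc k) (i + int k))"
proof -
  \<comment> \<open>Stated conditionally, so that the induction for the even case can use it at the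
    same \<open>k\<close>.\<close>
  have odd: "involutes n U (Mseq n U P 0) (Suc (2 * k)) = (\<lambda>i. Nseq n U P (Suc k) (i + int k))"
    if "involutes n U (Mseq n U P 0) (2 * k) = (\<lambda>i. Mseq n U P k (i + int k))" for k
    using that InvM_W_even[of k "Mseq n U P k"] by (simp add: Nseq_def)
  show even: "involutes n U (Mseq n U P 0) (2 * k) = (\<lambda>i. Mseq n U P k (i + int k))" for k
  proof (induction k)
    case (Suc k)
    have ad: "admissible n V (Nseq n U P (Suc k))"
      using admissible_InvM[OF admissible_Mseq[OF assms]] by (simp add: Nseq_def)
    have "involutes n U (Mseq n U P 0) (2 * Suc k)
        = InvM n (W (Suc (2 * k))) (involutes n U (Mseq n U P 0) (Suc (2 * k)))" by simp
    also have "\<dots> = (\<lambda>i. InvM n V (Nseq n U P (Suc k)) (i + int k))"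
      unfolding odd[OF Suc] by (rule InvM_W_odd)
    also have "\<dots> = (\<lambda>i. InvN n U (Nseq n U P (Suc k)) (i + int k + 1))"
      unfolding InvN_eq_InvM[OF ad] ..
    finally show ?case by (simp add: Nseq_def add.assoc add.commute[of 1])
  qed simp
  show "involutes n U (Mseq n U P 0) (Suc (2 * k)) = (\<lambda>i. Nseq n U P (Suc k) (i + int k))"
    by (rule odd[OF even])
qed

end

section \<open>Polygons of constant width\<close>

locale constant_width = convex_sym +
  fixes P :: "int \<Rightarrow> real^2" and c :: real and lam :: "int \<Rightarrow> real"
  assumes c_pos: "c > 0"
    and P_per: "P (i + 2 * int n) = P i"
    and lam_nonneg: "lam i \<ge> 0"
    and P_edge: "P (i + 1) - P i = lam i *\<^sub>R V i"
    and P_width: "P i - P (i + int n) = (2 * c) *\<^sub>R U i"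
begin

abbreviation M where "M \<equiv> Mseq n U P 0"

lemmas [simp del] = Mseq.simps

lemma M_eq: "M i = P i - c *\<^sub>R U i"
proof -
  have "P (i + int n) = P i - (2 * c) *\<^sub>R U i" using P_width[of i] by (simp add: algebra_simps)
  then show ?thesis by (simp add: Mseq.simps vec_eq_iff field_simps)
qed

lemma admissible_M: "admissible n U M"
  unfolding admissible_def
proof (intro conjI allI)
  fix i
  show "M (i + int n) = M i" using P_per[of i] by (simp add: Mseq.simps add.assoc add.commute)
  have "lam i *\<^sub>R V i = (lam i / A i) *\<^sub>R (U (i + 1) - U i)"
    using A_pos[of i] by (simp add: edge)
  then have "M (i + 1) - M i = (lam i / A i - c) *\<^sub>R (U (i + 1) - U i)"
    using P_edge[of i] unfolding M_eq by (simp add: algebra_simps)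
  then show "\<exists>a. M (i + 1) - M i = a *\<^sub>R (U (i + 1) - U i)" by blast
qed

lemma P_diff:
  assumes "a \<le> b"
  shows "P b - P a = (\<Sum>j\<in>{a..<b}. lam j *\<^sub>R V j)"
  using sum_window_telescope[of P a "nat (b - a)"] assms by (simp add: P_edge)

text \<open>The two chains \<open>P k, ..., P i\<close> and \<open>P (i + n), ..., P (k + 2 n)\<close> together span less than a half turn,
  so their determinant has a definite sign.\<close>
lemma diameter_side:
  assumes "k \<le> i" "i \<le> k + int n"
  shows "det2 (P k - M i) (U i) \<ge> 0"
proof -
  define a where "a = P i - P k"
  define b where "b = P (k + 2 * int n) - P (i + int n)"
  have "b = P k - P (i + int n)" by (simp add: b_def P_per)
  then have ab: "a + b = (2 * c) *\<^sub>R U i" using P_width[of i] by (simp add: a_def)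
  have "(2 * c) * det2 (P k - M i) (U i) = det2 (- a) (a + b)"
    unfolding ab M_eq by (simp add: a_def det2_simps)
  also have "\<dots> = det2 b a" using det2_swap[of a b] by (simp add: det2_simps)
  also have "det2 b a = (\<Sum>j'\<in>{k..<i}. \<Sum>j\<in>{i + int n..<k + 2 * int n}. lam j' * (lam j * det2 (V j) (V j')))"
    using assms unfolding a_def b_def
    by (simp add: P_diff det2_sum_left det2_sum_right det2_simps sum_distrib_left mult.left_commute)
  also have "\<dots> \<ge> 0"
  proof (intro sum_nonneg mult_nonneg_nonneg lam_nonneg)
    fix j j' assume "j' \<in> {k..<i}" "j \<in> {i + int n..<k + 2 * int n}"
    \<comment> \<open>Moved on by a full period, \<open>j'\<close> lies strictly between
      \<open>j\<close> and \<open>j + int n\<close>.\<close>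
    then have "det2 (V j) (V (j' + int n + int n)) > 0" using assms by (intro det_V_pos) auto
    then show "det2 (V j) (V j') \<ge> 0" unfolding V_sym minus_minus by simp
  qed
  finally show ?thesis using c_pos by (simp add: zero_le_mult_iff)
qed

text \<open>The sides of \<open>x\<close> with respect to the diameters through \<open>M i\<close>
  in direction \<open>U i\<close> form a sequence with a single sign change. The differences of the
  positions relative to the edge lines are negative multiples of it, so \<open>one_sign_step\<close>
  transfers the property.\<close>

lemma one_sign_P:
  assumes "x \<in> polycurve (2 * n) P"
  shows "one_sign n (supp U M x)"
proof -
  obtain k s where s: "0 \<le> s" "s \<le> 1" "x = (1 - s) *\<^sub>R P k + s *\<^sub>R P (k + 1)"
    using assms by (auto simp: polycurve_def closed_segment_def)
  \<comment> \<open>These \<open>n\<close> indices are exactly those at which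
    \<open>diameter_side\<close> applies to both ends of the edge containing
    \<open>x\<close>.\<close>
  have "det2 (x - M i) (U i) \<ge> 0" if "k + 1 \<le> i" "i < k + 1 + int n" for i
  proof -
    have "det2 (x - M i) (U i) = (1 - s) * det2 (P k - M i) (U i) + s * det2 (P (k + 1) - M i) (U i)"
      unfolding s(3) M_eq by (simp add: det2_simps algebra_simps)
    then show ?thesis
      using s(1,2) that diameter_side[of k i] diameter_side[of "k + 1" i] by simp
  qed
  then have os: "one_sign n (\<lambda>i. det2 (x - M i) (U i))"
    unfolding one_sign_def by (meson atLeastLessThan_iff)
  have step: "supp U M x i - supp U M x (i - 1) = - (B (i - 1) * det2 (x - M i) (U i))" for i
    using arg_cong[OF V_edge[of "i - 1"], of "det2 (x - M i)"] supp_eq[OF admissible_M, of x "i - 1"]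
    by (simp only: supp_def det2_simps diff_add_cancel)
  show ?thesis
  proof (rule one_sign_step[OF _ _ step _ os])
    show "supp U M x (i + int n) = - supp U M x i" for i by (rule supp_anti[OF admissible_M])
    show "B (i - 1) \<ge> 0" for i using B_pos by (rule less_imp_le)
  qed (use n2 in simp)
qed

lemma
  shows polycurve_Mseq: "polycurve (2 * n) (involutes n U M (2 * k)) = polycurve (2 * n) (Mseq n U P k)"
    and polycurve_Nseq: "polycurve (2 * n) (involutes n U M (Suc (2 * k))) = polycurve (2 * n) (Nseq n U P (Suc k))"
proof -
  have shift: "polycurve (2 * n) (\<lambda>i. X (i + d)) = polycurve (2 * n) X"
    if "\<And>i. X (i + int n) = X i" for X :: "int \<Rightarrow> real^2" and d
  proof (rule polycurve_shift)
    show "X (i + int (2 * n)) = X i" for i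
      using that[of i] that[of "i + int n"] by (simp add: algebra_simps)
  qed (use n2 in simp)
  have "Mseq n U P k (i + int n) = Mseq n U P k i" for i
    using admissible_Mseq[OF admissible_M, of k] by (simp add: admissible_def)
  then show "polycurve (2 * n) (involutes n U M (2 * k)) = polycurve (2 * n) (Mseq n U P k)"
    unfolding involutes_even[OF admissible_M] by (rule shift)
  have "Nseq n U P (Suc k) (i + int n) = Nseq n U P (Suc k) i" for i
    using admissible_InvM[OF admissible_Mseq[OF admissible_M, of k]] by (simp add: Nseq_def admissible_def)
  then show "polycurve (2 * n) (involutes n U M (Suc (2 * k))) = polycurve (2 * n) (Nseq n U P (Suc k))"
    unfolding involutes_odd[OF admissible_M] by (rule shift)
qed

lemma center_in_region:
  assumes "moment M x = 0"
  shows "x \<in> region_rel (polycurve (2 * n) P) (polycurve (2 * n) (involutes n U M k))"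
proof (rule convex_sym.moment_zero_in_region[OF convex_sym_W admissible_involutes[OF admissible_M]])
  show "one_sign n (supp (W k) (involutes n U M k) p)" if "p \<in> polycurve (2 * n) P" for p
    by (rule one_sign_involutes[OF admissible_M one_sign_P[OF that]])
  show "convex_sym.moment n (W k) (involutes n U M k) x = 0"
    using moment_involutes[OF admissible_M, of k x] assms by (rule trans)
qed

lemma other_not_in_region:
  assumes x: "moment M x = 0" and y: "y \<noteq> x"
  shows "\<exists>k. y \<notin> region_rel (polycurve (2 * n) P) (polycurve (2 * n) (involutes n U M (2 * k)))"
proof -
  have "U 0 \<noteq> 0" using det_UV[of 0] by (metis det2_simps(10) zero_neq_one)
  \<comment> \<open>A point of \<open>P\<close> other than \<open>x\<close> is needed as the end of
    the path; two opposite vertices are distinct, so one of them serves.\<close>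
  then have "P 0 \<noteq> P (int n)" using P_width[of 0] c_pos by auto
  then obtain i where i: "i \<in> {0, int n}" "P i \<noteq> x" by auto
  then have Pi: "P i \<in> polycurve (2 * n) P"
    using n2 unfolding polycurve_def by (intro UN_I[of i]) auto
  \<comment> \<open>With this radius both \<open>y\<close> and \<open>P i\<close> lie outside the
    open ball that eventually contains the curve.\<close>
  define e where "e = min (dist y x) (dist (P i) x)"
  have "e > 0" using y i(2) by (simp add: e_def)
  from involutes_tendsto_uniformly[OF admissible_M x this]
  obtain K where "\<And>j. dist (involutes n U M (2 * K) j) x < e" by (metis le_add2 mult_2)
  then have "y \<notin> region_rel (polycurve (2 * n) P) (polycurve (2 * n) (involutes n U M (2 * K)))"
    by (rule not_in_region[OF _ _ Pi]) (simp_all add: e_def)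
  then show ?thesis by blast
qed

lemma
  assumes x: "moment M x = 0"
  shows Mseq_tendsto: "(\<lambda>k. Mseq n U P k i) \<longlonglongrightarrow> x"
    and Nseq_tendsto: "(\<lambda>k. Nseq n U P (Suc k) i) \<longlonglongrightarrow> x"
proof -
  have MN: "Mseq n U P k i = involutes n U M (2 * k) (i - int k)"
    "Nseq n U P (Suc k) i = involutes n U M (Suc (2 * k)) (i - int k)" for k
    unfolding involutes_even[OF admissible_M] involutes_odd[OF admissible_M] by simp_all
  have lim: "\<exists>K. \<forall>k\<ge>K. dist (involutes n U M (2 * k) (i - int k)) x < e"
    "\<exists>K. \<forall>k\<ge>K. dist (involutes n U M (Suc (2 * k)) (i - int k)) x < e" if "e > 0" for e
  proof -
    from involutes_tendsto_uniformly[OF admissible_M x that]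
    obtain K where K: "\<And>k j. k \<ge> K \<Longrightarrow> dist (involutes n U M k j) x < e" by blast
    show "\<exists>K. \<forall>k\<ge>K. dist (involutes n U M (2 * k) (i - int k)) x < e"
      by (intro exI[of _ K] allI impI K) linarith
    show "\<exists>K. \<forall>k\<ge>K. dist (involutes n U M (Suc (2 * k)) (i - int k)) x < e"
      by (intro exI[of _ K] allI impI K) linarith
  qed
  show "(\<lambda>k. Mseq n U P k i) \<longlonglongrightarrow> x"
    unfolding MN by (rule metric_LIMSEQ_I) (rule lim)
  show "(\<lambda>k. Nseq n U P (Suc k) i) \<longlonglongrightarrow> x"
    unfolding MN by (rule metric_LIMSEQ_I) (rule lim)
qed

end

theorem theorem5p1:
  fixes n :: nat and U P :: "int \<Rightarrow> real^2" and c :: real and lam :: "int \<Rightarrow> real"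
  assumes n2: "n \<ge> 2"
    and U_sym: "\<And>i. U (i + int n) = - U i"
    and U_per: "\<And>i. U (i + 2 * int n) = U i"
    and U_distinct: "inj_on U {0..<2 * int n}"
    and U_convex: "\<And>i j. j mod (2 * int n) \<noteq> i mod (2 * int n) \<Longrightarrow>
                      j mod (2 * int n) \<noteq> (i + 1) mod (2 * int n) \<Longrightarrow>
                      det2 (U (i+1) - U i) (U j - U i) > 0"
    and c_pos: "c > 0"
    and P_per: "\<And>i. P (i + 2 * int n) = P i"
    and P_int: "interior (convex hull (P ` {0..<2 * int n})) \<noteq> {}"
    and lam_nonneg: "\<And>i. lam i \<ge> 0"
    and P_edges: "\<And>i. P (i+1) - P i = lam i *\<^sub>R Vvec U i"
    and P_width: "\<And>i. P i - P (i + int n) = (2 * c) *\<^sub>R U i"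
  shows "\<exists>Ctr. (\<Inter>k. region_rel (polycurve (2*n) P) (polycurve (2*n) (Mseq n U P k)) \<inter>
                   region_rel (polycurve (2*n) P) (polycurve (2*n) (Nseq n U P (Suc k)))) = {Ctr}
            \<and> (\<forall>i. (\<lambda>k. Mseq n U P k i) \<longlonglongrightarrow> Ctr)
            \<and> (\<forall>i. (\<lambda>k. Nseq n U P (Suc k) i) \<longlonglongrightarrow> Ctr)"
proof -
  interpret constant_width n U P c lam
    using n2 U_sym U_convex c_pos P_per lam_nonneg P_edges P_width by unfold_locales
  obtain x where x: "moment M x = 0" using moment_zero_exists by blast
  show ?thesis
  proof (intro exI[of _ x] conjI allI Mseq_tendsto[OF x] Nseq_tendsto[OF x] equalityI subsetI)
    fix y assume y: "y \<in> (\<Inter>k. region_rel (polycurve (2*n) P) (polycurve (2*n) (Mseq n U P k)) \<inter>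
                   region_rel (polycurve (2*n) P) (polycurve (2*n) (Nseq n U P (Suc k))))"
    show "y \<in> {x}"
      using y other_not_in_region[OF x, of y] unfolding polycurve_Mseq by blast
  next
    fix y assume "y \<in> {x}"
    then show "y \<in> (\<Inter>k. region_rel (polycurve (2*n) P) (polycurve (2*n) (Mseq n U P k)) \<inter>
                   region_rel (polycurve (2*n) P) (polycurve (2*n) (Nseq n U P (Suc k))))"
      using center_in_region[OF x] unfolding polycurve_Mseq[symmetric] polycurve_Nseq[symmetric] by blast
  qed
qed

end
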